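(* Let $\gamma,\lambda>0$ and $\alpha\in(0,1)$. Assume that each $\phi_i:\mathbb{R}\to\mathbb{R}$ ($i=1,\dots,n$) is convex and differentiable with $(1/\gamma)$-Lipschitz continuous derivative, and that $g:\mathbb{R}^d\to\mathbb{R}$ is $\lambda$-strongly convex with respect to $\|\cdot\|_2$. Let $a_1,\dots,a_n\in\mathbb{R}^d$, let $\bar R=\frac1n\sum_{i=1}^n\|a_i\|_2>0$, and let $(x^\star,y^\star)$ be the unique saddle point of $f(x,y)=\frac1n\sum_{i=1}^n(y_i\langle a_i,x\rangle-\phi_i^*(y_i))+g(x)$ (min over $x\in\mathbb{R}^d$, max over $y\in\mathbb{R}^n$). If the parameters of the SPDC method with weighted sampling are chosen as $$\tau=\frac{\alpha}{2\bar R}\sqrt{\frac{\gamma}{n\lambda}},\qquad \sigma=\frac{\alpha}{2\bar R}\sqrt{\frac{n\lambda}{\gamma}},\qquad \theta=1-\left(\frac{n}{1-\alpha}+\frac{\bar R}{\alpha}\sqrt{\frac{n}{\lambda\gamma}}\right)^{-1},$$ then for each $t\ge1$, $$\Bigl(\frac1{2\tau}+\lambda\Bigr)\mathbb{E}\bigl[\|x^{(t)}-x^\star\|_2^2\bigr]+\Bigl(\frac1{4\sigma}+\frac\gamma n\Bigr)\mathbb{E}\bigl[\|y^{(t)}-y^\star\|_2^2\bigr]\le\theta^{t}\left(\Bigl(\frac1{2\tau}+\lambda\Bigr)\|x^{(0)}-x^\star\|_2^2+\Bigl(\frac1{2\sigma}+\frac{\gamma}{1-\alpha}\Bigr)\|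y^{(0)}-y^\star\|_2^2\right).$$
   Context: $\phi_i^*(\beta)=\sup_{z\in\mathbb{R}}\{z\beta-\phi_i(z)\}$ is the convex conjugate (values in $(-\infty,+\infty]$). $g$ is $\lambda$-strongly convex if $g(x)\ge g(z)+\langle g'(z),x-z\rangle+\frac\lambda2\|x-z\|_2^2$ for all $x,z\in\mathbb{R}^d$ and all $g'(z)\in\partial g(z)$. Expectations are over the random indices chosen by the algorithm. SPDC method with weighted sampling, parameters $\tau,\sigma,\theta$ and initial points $x^{(0)}\in\mathbb{R}^d,y^{(0)}\in\mathbb{R}^n$: set $\overline x^{(0)}=x^{(0)}$ and $u^{(0)}=\frac1n\sum_{i=1}^n y_i^{(0)}a_i$. For $t=0,1,2,\dots$: pick at random (independently of the previous iterations) an index $k\in\{1,\dots,n\}$ with probability $$p_k=(1-\alpha)\frac1n+\alpha\,\frac{\|a_k\|_2}{\sum_{i=1}^n\|a_i\|_2},$$ and set - $y_i^{(t+1)}=\arg\max_{\beta\in\mathbb{R}}\{\beta\langle a_i,\overline x^{(t)}\rangle-\phi_i^*(\beta)-\frac{p_i n}{2\sigma}(\beta-y_i^{(t)})^2\}$ if $i=k$, and $y_i^{(t+1)}=y_i^{(t)}$ if $i\ne k$; - $u^{(t+1)}=u^{(t)}+\frac1n(y_k^{(t+1)}-y_k^{(t)})a_k$; - $x^{(t+1)}=\arg\min_{x\in\mathbb{R}^d}\{g(x)+\langle u^{(t)}+\frac1{p_k}(u^{(t+1)}-u^{(t)}),x\rangle+\frac1{2\tau}\|x-x^{(t)}\|_2^2\}$;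 - $\overline x^{(t+1)}=x^{(t+1)}+\theta(x^{(t+1)}-x^{(t)})$. *)

theory Defs
  imports "HOL-Probability.Probability"
begin

definition convex_conjugate :: "(real \<Rightarrow> real) \<Rightarrow> real \<Rightarrow> ereal" where
  "convex_conjugate \<phi> \<beta> = (SUP z. ereal (z * \<beta> - \<phi> z))"

definition subdifferential :: "('a::real_inner \<Rightarrow> real) \<Rightarrow> 'a \<Rightarrow> 'a set" where
  "subdifferential g z = {v. \<forall>x. g x \<ge> g z + v \<bullet> (x - z)}"

text \<open>Convexity is required explicitly: the subgradient inequality alone would hold vacuously
  at points where the subdifferential is empty.\<close>

definition strongly_convex :: "real \<Rightarrow> ('a::real_inner \<Rightarrow> real) \<Rightarrow> bool" where
  "strongly_convex \<mu> g \<longleftrightarrow> convex_on UNIV g \<and>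
     (\<forall>x z. \<forall>v \<in> subdifferential g z. g x \<ge> g z + v \<bullet> (x - z) + \<mu> / 2 * (norm (x - z))\<^sup>2)"

definition saddle_point :: "('a \<Rightarrow> 'b \<Rightarrow> ereal) \<Rightarrow> 'a \<Rightarrow> 'b \<Rightarrow> bool" where
  "saddle_point f x\<^sub>s y\<^sub>s \<longleftrightarrow> (\<forall>x y. f x\<^sub>s y \<le> f x\<^sub>s y\<^sub>s \<and> f x\<^sub>s y\<^sub>s \<le> f x y\<^sub>s)"

text \<open>The index set \<open>{1..n}\<close> is the finite type \<open>'n\<close>, so \<open>n = CARD('n)\<close>.
  The conjugates never take the value \<open>-\<infinity>\<close>, so the Lagrangian takes values in
  \<open>[-\<infinity>, \<infinity>)\<close> and no sum below mixes infinities of opposite sign.\<close>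

definition lagrangian ::
  "('n::finite \<Rightarrow> real ^ 'd) \<Rightarrow> ('n \<Rightarrow> real \<Rightarrow> real) \<Rightarrow> (real ^ 'd \<Rightarrow> real) \<Rightarrow>
   real ^ 'd \<Rightarrow> real ^ 'n \<Rightarrow> ereal" where
  "lagrangian a \<phi> g x y =
     ereal (1 / real CARD('n)) *
       (\<Sum>i\<in>UNIV. ereal (y $ i * (a i \<bullet> x)) - convex_conjugate (\<phi> i) (y $ i)) + ereal (g x)"

definition sampling_prob :: "real \<Rightarrow> ('n::finite \<Rightarrow> real ^ 'd) \<Rightarrow> 'n \<Rightarrow> real" where
  "sampling_prob \<alpha> a k =
     (1 - \<alpha>) * (1 / real CARD('n)) + \<alpha> * (norm (a k) / (\<Sum>i\<in>UNIV. norm (a i)))"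

text \<open>A state is the tuple \<open>(x, y, u, x\<^sub>b)\<close>, where \<open>x\<^sub>b\<close> is the extrapolated primal point.\<close>

type_synonym ('n, 'd) spdc_state = "(real ^ 'd) \<times> (real ^ 'n) \<times> (real ^ 'd) \<times> (real ^ 'd)"

definition spdc_init ::
  "('n::finite \<Rightarrow> real ^ 'd) \<Rightarrow> real ^ 'd \<Rightarrow> real ^ 'n \<Rightarrow> ('n, 'd) spdc_state" where
  "spdc_init a x\<^sub>0 y\<^sub>0 = (x\<^sub>0, y\<^sub>0, (1 / real CARD('n)) *\<^sub>R (\<Sum>i\<in>UNIV. (y\<^sub>0 $ i) *\<^sub>R a i), x\<^sub>0)"

definition spdc_step ::
  "('n::finite \<Rightarrow> real ^ 'd) \<Rightarrow> ('n \<Rightarrow> real \<Rightarrow> real) \<Rightarrow> (real ^ 'd \<Rightarrow> real) \<Rightarrow>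
   real \<Rightarrow> real \<Rightarrow> real \<Rightarrow> real \<Rightarrow> 'n \<Rightarrow> ('n, 'd) spdc_state \<Rightarrow> ('n, 'd) spdc_state" where
  "spdc_step a \<phi> g \<alpha> \<tau> \<sigma> \<theta> k = (\<lambda>(x, y, u, x\<^sub>b).
     let n = real CARD('n);
         p = sampling_prob \<alpha> a;
         y' = (\<chi> i. if i = k
           then arg_max (\<lambda>\<beta>. ereal (\<beta> * (a i \<bullet> x\<^sub>b)) - convex_conjugate (\<phi> i) \<beta>
                              - ereal (p i * n / (2 * \<sigma>) * (\<beta> - y $ i)\<^sup>2)) (\<lambda>_. True)
           else y $ i);
         u' = u + (1 / n * (y' $ k - y $ k)) *\<^sub>R a k;
         x' = arg_min (\<lambda>w. g w + (u + (1 / p k) *\<^sub>R (u' - u)) \<bullet> w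
                            + 1 / (2 * \<tau>) * (norm (w - x))\<^sup>2) (\<lambda>_. True)
     in (x', y', u', x' + \<theta> *\<^sub>R (x' - x)))"

text \<open>The iterates as a deterministic function of the sequence \<open>ks\<close> of sampled indices;
  \<open>ks t\<close> is the index used to pass from iteration \<open>t\<close> to iteration \<open>Suc t\<close>.\<close>

primrec spdc ::
  "('n::finite \<Rightarrow> real ^ 'd) \<Rightarrow> ('n \<Rightarrow> real \<Rightarrow> real) \<Rightarrow> (real ^ 'd \<Rightarrow> real) \<Rightarrow>
   real \<Rightarrow> real \<Rightarrow> real \<Rightarrow> real \<Rightarrow> real ^ 'd \<Rightarrow> real ^ 'n \<Rightarrow>
   (nat \<Rightarrow> 'n) \<Rightarrow> nat \<Rightarrow> ('n, 'd) spdc_state" where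
  "spdc a \<phi> g \<alpha> \<tau> \<sigma> \<theta> x\<^sub>0 y\<^sub>0 ks 0 = spdc_init a x\<^sub>0 y\<^sub>0"
| "spdc a \<phi> g \<alpha> \<tau> \<sigma> \<theta> x\<^sub>0 y\<^sub>0 ks (Suc t) =
     spdc_step a \<phi> g \<alpha> \<tau> \<sigma> \<theta> (ks t) (spdc a \<phi> g \<alpha> \<tau> \<sigma> \<theta> x\<^sub>0 y\<^sub>0 ks t)"

definition spdc_primal ::
  "('n::finite \<Rightarrow> real ^ 'd) \<Rightarrow> ('n \<Rightarrow> real \<Rightarrow> real) \<Rightarrow> (real ^ 'd \<Rightarrow> real) \<Rightarrow>
   real \<Rightarrow> real \<Rightarrow> real \<Rightarrow> real \<Rightarrow> real ^ 'd \<Rightarrow> real ^ 'n \<Rightarrow> (nat \<Rightarrow> 'n) \<Rightarrow> nat \<Rightarrow> real ^ 'd" where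
  "spdc_primal a \<phi> g \<alpha> \<tau> \<sigma> \<theta> x\<^sub>0 y\<^sub>0 ks t = fst (spdc a \<phi> g \<alpha> \<tau> \<sigma> \<theta> x\<^sub>0 y\<^sub>0 ks t)"

definition spdc_dual ::
  "('n::finite \<Rightarrow> real ^ 'd) \<Rightarrow> ('n \<Rightarrow> real \<Rightarrow> real) \<Rightarrow> (real ^ 'd \<Rightarrow> real) \<Rightarrow>
   real \<Rightarrow> real \<Rightarrow> real \<Rightarrow> real \<Rightarrow> real ^ 'd \<Rightarrow> real ^ 'n \<Rightarrow> (nat \<Rightarrow> 'n) \<Rightarrow> nat \<Rightarrow> real ^ 'n" where
  "spdc_dual a \<phi> g \<alpha> \<tau> \<sigma> \<theta> x\<^sub>0 y\<^sub>0 ks t = fst (snd (spdc a \<phi> g \<alpha> \<tau> \<sigma> \<theta> x\<^sub>0 y\<^sub>0 ks t))"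

end

theory Submission imports Defs begin

text \<open>Let \<open>d\<close> be the last increment of the primal iterate, \<open>u\<^sub>s = 1/n \<Sum> (y\<^sub>s)\<^sub>i a\<^sub>i\<close> and
  \<open>w\<^sub>i = 1/(2\<sigma>) + \<gamma>/(p\<^sub>i n)\<close>. The potential
  \<open>(1/(2\<tau>) + \<mu>) |x - x\<^sub>s|\<^sup>2 + \<Sum> w\<^sub>i (y\<^sub>i - (y\<^sub>s)\<^sub>i)\<^sup>2 + \<langle>u - u\<^sub>s, d\<rangle> + |d|\<^sup>2/(4\<tau>)\<close>
  contracts by \<open>\<theta>\<close> in expectation at every step: the dual update is a proximal step whose optimality
  condition reads \<open>\<beta> = \<phi>\<^sub>k'(z)\<close>, so cocoercivity of \<open>\<phi>\<^sub>k'\<close> bounds it, while strong monotonicity of the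
  subdifferential of \<open>g\<close> bounds the primal update. The remaining cross terms involve
  \<open>|a\<^sub>k|/(n p\<^sub>k) \<le> R/\<alpha>\<close> and are absorbed by Young's inequality since \<open>\<tau> (R/\<alpha>)\<^sup>2 = 1/(4\<sigma>)\<close>.
  The same inequality absorbs \<open>\<langle>u - u\<^sub>s, d\<rangle>\<close> at the end, at the price of half of the \<open>1/(2\<sigma>)\<close> weight.\<close>

section \<open>Smooth convex functions and their conjugates\<close>

lemma arg_max_eqI:
  fixes f :: "'a \<Rightarrow> 'b::linorder"
  assumes "\<And>w. w \<noteq> b \<Longrightarrow> f w < f b"
  shows "arg_max f (\<lambda>_. True) = b"
  unfolding arg_max_def is_arg_max_def
proof (rule some_equality)
  show "True \<and> \<not> (\<exists>w. True \<and> f b < f w)"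
    using assms by (metis less_asym')
next
  fix z assume "True \<and> \<not> (\<exists>w. True \<and> f z < f w)"
  then show "z = b" using assms by blast
qed

text \<open>\<open>arg_min\<close> is a choice operator, so it picks a minimizer as soon as one
  exists; \<open>m\<close> is the witness.\<close>

lemma arg_min_le:
  fixes f :: "'a \<Rightarrow> 'b::linorder"
  assumes "\<And>w. f m \<le> f w"
  shows "f (arg_min f (\<lambda>_. True)) \<le> f w"
proof -
  have "is_arg_min f (\<lambda>_. True) (arg_min f (\<lambda>_. True))"
    unfolding arg_min_def
    by (rule someI[of _ m]) (use assms in \<open>auto simp: is_arg_min_def not_less\<close>)
  then show ?thesis by (simp add: is_arg_min_def not_less)
qed

locale smooth_convex =
  fixes \<phi> :: "real \<Rightarrow> real" and \<gamma> :: real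
  assumes gamma_pos: "\<gamma> > 0"
    and convex: "convex_on UNIV \<phi>"
    and diff: "\<And>z. \<phi> differentiable (at z)"
    and lipschitz: "(1 / \<gamma>)-lipschitz_on UNIV (deriv \<phi>)"
begin

lemma has_deriv: "(\<phi> has_real_derivative deriv \<phi> z) (at z within A)"
  using diff DERIV_deriv_iff_real_differentiable has_field_derivative_at_within by blast

lemma above_tangent: "\<phi> w \<ge> \<phi> z + deriv \<phi> z * (w - z)"
  using convex_on_imp_above_tangent[of UNIV \<phi> z w "deriv \<phi> z"] convex has_deriv by auto

lemma lipschitz_abs: "\<bar>deriv \<phi> w - deriv \<phi> z\<bar> \<le> \<bar>w - z\<bar> / \<gamma>"
  using lipschitz_onD[OF lipschitz, of w z] by (simp add: dist_real_def)

text \<open>The quadratic upper bound that a Lipschitz derivative gives, obtained from monotonicity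
  on each side of \<open>z\<close>.\<close>

lemma descent: "\<phi> w \<le> \<phi> z + deriv \<phi> z * (w - z) + (w - z)\<^sup>2 / (2 * \<gamma>)"
proof -
  \<comment> \<open>Up to the constant \<open>\<phi> z\<close> this is the left side minus the right
    side. By \<open>lipschitz_abs\<close> its derivative is nonpositive to the right of
    \<open>z\<close> and nonnegative to the left, so \<open>z\<close> maximizes it.\<close>
  define \<psi> where "\<psi> = (\<lambda>w. \<phi> w - deriv \<phi> z * (w - z) - (w - z)\<^sup>2 / (2 * \<gamma>))"
  have der: "(\<psi> has_real_derivative deriv \<phi> w - deriv \<phi> z - (w - z) / \<gamma>) (at w)" for w
    unfolding \<psi>_def using gamma_pos
    by (auto intro!: derivative_eq_intros has_deriv simp: field_simps)
  have "\<psi> w \<le> \<psi> z"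
  proof (cases "z \<le> w")
    case True
    show ?thesis
    proof (rule DERIV_nonpos_imp_nonincreasing[OF True])
      fix v assume "z \<le> v" "v \<le> w"
      then show "\<exists>y. (\<psi> has_real_derivative y) (at v) \<and> y \<le> 0"
        using der[of v] lipschitz_abs[of v z] by (intro exI conjI) auto
    qed
  next
    case False
    then have "w \<le> z" by simp
    then show ?thesis
    proof (rule DERIV_nonneg_imp_nondecreasing)
      fix v assume "w \<le> v" "v \<le> z"
      then have "\<bar>v - z\<bar> / \<gamma> = - ((v - z) / \<gamma>)" by (simp add: minus_divide_left)
      then show "\<exists>y. (\<psi> has_real_derivative y) (at v) \<and> 0 \<le> y"
        using der[of v] lipschitz_abs[of v z] by (intro exI conjI) auto
    qed
  qed
  then show ?thesis by (simp add: \<psi>_def)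
qed

lemma conjugate_deriv: "convex_conjugate \<phi> (deriv \<phi> z) = ereal (z * deriv \<phi> z - \<phi> z)"
  unfolding convex_conjugate_def
proof (rule antisym)
  show "(SUP w. ereal (w * deriv \<phi> z - \<phi> w)) \<le> ereal (z * deriv \<phi> z - \<phi> z)"
    using above_tangent[of z] by (intro SUP_least) (auto simp: algebra_simps)
qed (rule SUP_upper, simp)

text \<open>Strong convexity of the conjugate, dual to \<open>descent\<close>: replacing
  \<open>\<phi>\<close> by its quadratic upper bound can only lower the supremum.\<close>

lemma conjugate_lower:
  "convex_conjugate \<phi> \<beta> \<ge> ereal (z * \<beta> - \<phi> z + \<gamma> / 2 * (\<beta> - deriv \<phi> z)\<^sup>2)"
proof -
  \<comment> \<open>The maximizer of \<open>w * \<beta>\<close> minus the quadratic upper bound of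
    \<open>\<phi>\<close> at \<open>z\<close>.\<close>
  define w where "w = z + \<gamma> * (\<beta> - deriv \<phi> z)"
  have "z * \<beta> - \<phi> z + \<gamma> / 2 * (\<beta> - deriv \<phi> z)\<^sup>2
      = w * \<beta> - (\<phi> z + deriv \<phi> z * (w - z) + (w - z)\<^sup>2 / (2 * \<gamma>))"
    using gamma_pos by (simp add: w_def field_simps power2_eq_square)
  also have "\<dots> \<le> w * \<beta> - \<phi> w" using descent[of w z] by simp
  finally have "ereal (z * \<beta> - \<phi> z + \<gamma> / 2 * (\<beta> - deriv \<phi> z)\<^sup>2) \<le> ereal (w * \<beta> - \<phi> w)"
    by simp
  also have "\<dots> \<le> convex_conjugate \<phi> \<beta>"
    unfolding convex_conjugate_def by (rule SUP_upper) simp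
  finally show ?thesis .
qed

lemma conjugate_ne_minf: "convex_conjugate \<phi> \<beta> \<noteq> -\<infinity>"
  using conjugate_lower[of 0 \<beta>] by auto

text \<open>Sum of two instances of \<open>conjugate_lower\<close>, at the slopes of
  \<open>z\<close> and \<open>w\<close>, where \<open>conjugate_deriv\<close> makes the conjugate
  explicit.\<close>

lemma cocoercive: "(z - w) * (deriv \<phi> z - deriv \<phi> w) \<ge> \<gamma> * (deriv \<phi> z - deriv \<phi> w)\<^sup>2"
proof -
  have "z * deriv \<phi> z - \<phi> z \<ge> w * deriv \<phi> z - \<phi> w + \<gamma> / 2 * (deriv \<phi> z - deriv \<phi> w)\<^sup>2"
    using conjugate_lower[of w "deriv \<phi> z"] by (simp add: conjugate_deriv)
  moreover have "w * deriv \<phi> w - \<phi> w \<ge> z * deriv \<phi> w - \<phi> z + \<gamma> / 2 * (deriv \<phi> w - deriv \<phi> z)\<^sup>2"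
    using conjugate_lower[of z "deriv \<phi> w"] by (simp add: conjugate_deriv)
  moreover have "(deriv \<phi> w - deriv \<phi> z)\<^sup>2 = (deriv \<phi> z - deriv \<phi> w)\<^sup>2"
    by (rule power2_commute)
  ultimately show ?thesis by (simp add: algebra_simps)
qed

lemma deriv_mono: "z \<le> w \<Longrightarrow> deriv \<phi> z \<le> deriv \<phi> w"
proof (rule ccontr)
  assume "z \<le> w" "\<not> deriv \<phi> z \<le> deriv \<phi> w"
  then have "(w - z) * (deriv \<phi> w - deriv \<phi> z) \<le> 0" "\<gamma> * (deriv \<phi> w - deriv \<phi> z)\<^sup>2 > 0"
    using gamma_pos by (auto simp: mult_le_0_iff)
  then show False using cocoercive[of w z] by linarith
qed

lemma resolvent_exists:
  assumes "c > 0"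
  obtains z where "z + c * deriv \<phi> z = s"
proof -
  define h where "h z = z + c * deriv \<phi> z" for z
  \<comment> \<open>By monotonicity of the derivative, the points 0 and \<open>m\<close> bracket the
    solution for the intermediate value theorem.\<close>
  define m where "m = s - c * deriv \<phi> 0"
  have "continuous_on UNIV (deriv \<phi>)"
    using lipschitz by (rule lipschitz_on_continuous_on)
  then have cont: "continuous_on {min 0 m..max 0 m} h"
    unfolding h_def by (auto intro!: continuous_intros intro: continuous_on_subset)
  have "c * deriv \<phi> (min 0 m) \<le> c * deriv \<phi> 0" "c * deriv \<phi> 0 \<le> c * deriv \<phi> (max 0 m)"
    using assms by (auto intro!: mult_left_mono deriv_mono)
  then have "h (min 0 m) \<le> s" "s \<le> h (max 0 m)"
    by (auto simp: h_def m_def min_def max_def split: if_splits)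
  from IVT'[OF this _ cont] obtain z where "h z = s" by fastforce
  then show ?thesis using that by (simp add: h_def)
qed

text \<open>Optimality of the dual update, parametrized by the point \<open>z\<close> at which the
  maximizer is the slope of \<open>\<phi>\<close>; this avoids subgradients of the extended-real
  conjugate.\<close>

lemma prox_arg_max:
  assumes "c > 0"
  obtains z where
    "arg_max (\<lambda>\<beta>. ereal (\<beta> * s) - convex_conjugate \<phi> \<beta> - ereal (c / 2 * (\<beta> - b)\<^sup>2)) (\<lambda>_. True) = deriv \<phi> z"
    "z = s - c * (deriv \<phi> z - b)"
proof -
  obtain z where "z + c * deriv \<phi> z = s + c * b"
    using resolvent_exists[OF assms] .
  then have z: "z = s - c * (deriv \<phi> z - b)" by (simp add: algebra_simps)
  define obj where "obj \<beta> = ereal (\<beta> * s) - convex_conjugate \<phi> \<beta> - ereal (c / 2 * (\<beta> - b)\<^sup>2)" for \<beta>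
  have "obj \<beta> < obj (deriv \<phi> z)" if "\<beta> \<noteq> deriv \<phi> z" for \<beta>
  proof -
    define d where "d = deriv \<phi> z"
    have "c / 2 * (\<beta> - d)\<^sup>2 > 0" "\<gamma> / 2 * (\<beta> - d)\<^sup>2 > 0"
      using that assms gamma_pos by (auto simp: d_def)
    \<comment> \<open>With the conjugate replaced by its lower bound from
      \<open>conjugate_lower\<close>, the objective is a quadratic in \<open>\<beta>\<close> that
      peaks at \<open>d\<close>; the two positive squares above are its drop, so the maximum is
      strict.\<close>
    moreover have "\<beta> * s - (z * \<beta> - \<phi> z + \<gamma> / 2 * (\<beta> - d)\<^sup>2) - c / 2 * (\<beta> - b)\<^sup>2
        = d * s - (z * d - \<phi> z) - c / 2 * (d - b)\<^sup>2 - c / 2 * (\<beta> - d)\<^sup>2 - \<gamma> / 2 * (\<beta> - d)\<^sup>2"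
    proof -
      have s: "s = z + c * (d - b)" using z by (simp add: d_def)
      show ?thesis unfolding s by (simp add: power2_eq_square field_simps)
    qed
    ultimately have lt: "\<beta> * s - (z * \<beta> - \<phi> z + \<gamma> / 2 * (\<beta> - d)\<^sup>2) - c / 2 * (\<beta> - b)\<^sup>2
        < d * s - (z * d - \<phi> z) - c / 2 * (d - b)\<^sup>2" by linarith
    show ?thesis
      using conjugate_lower[of z \<beta>] lt conjugate_deriv[of z]
      unfolding obj_def d_def[symmetric]
      by (cases "convex_conjugate \<phi> \<beta>") (auto simp: mult.commute)
  qed
  then have "arg_max obj (\<lambda>_. True) = deriv \<phi> z" by (rule arg_max_eqI)
  then show ?thesis using that z unfolding obj_def by blast
qed

end

section \<open>Proximal steps of strongly convex functions\<close>

lemma strongly_convex_monotone: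
  assumes "strongly_convex \<mu> g" "p \<in> subdifferential g z" "q \<in> subdifferential g w"
  shows "(p - q) \<bullet> (z - w) \<ge> \<mu> * (norm (z - w))\<^sup>2"
proof -
  have "g w \<ge> g z + p \<bullet> (w - z) + \<mu> / 2 * (norm (w - z))\<^sup>2"
    and "g z \<ge> g w + q \<bullet> (z - w) + \<mu> / 2 * (norm (z - w))\<^sup>2"
    using assms unfolding strongly_convex_def by blast+
  then show ?thesis by (simp add: norm_minus_commute[of w z] inner_diff algebra_simps)
qed

text \<open>A subgradient bounds \<open>g\<close> below by an affine function, so the quadratic term
  forces growth at infinity and a minimizer over a large ball is global.\<close>

lemma prox_minimizer_exists:
  fixes g :: "'a::euclidean_space \<Rightarrow> real"
  assumes "convex_on UNIV g" "q \<in> subdifferential g z" "\<tau> > 0"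
  obtains m where
    "\<And>w. g m + v \<bullet> m + 1 / (2 * \<tau>) * (norm (m - x))\<^sup>2 \<le> g w + v \<bullet> w + 1 / (2 * \<tau>) * (norm (w - x))\<^sup>2"
proof -
  define F where "F w = g w + v \<bullet> w + 1 / (2 * \<tau>) * (norm (w - x))\<^sup>2" for w
  have cont: "continuous_on A F" for A
    unfolding F_def using convex_on_continuous[OF open_UNIV assms(1)] assms(3)
    by (auto intro!: continuous_intros intro: continuous_on_subset)
  define c where "c = 1 / (2 * \<tau>)"
  define A where "A = \<bar>g z + q \<bullet> (x - z) - g x\<bar>"
  define B where "B = norm (q + v)"
  \<comment> \<open>Radius beyond which \<open>c * r\<^sup>2\<close> outweighs
    \<open>A + B * r\<close>: \<open>r \<ge> 1\<close> turns \<open>A\<close> into at most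
    \<open>A * r\<close>, and \<open>c * r \<ge> A + B\<close> does the rest.\<close>
  define \<rho> where "\<rho> = max 1 ((A + B) / c)"
  have c: "c > 0" using assms(3) by (simp add: c_def)
  have outside: "F x \<le> F w" if "norm (w - x) > \<rho>" for w
  proof -
    define r where "r = norm (w - x)"
    have r: "r \<ge> 1" "c * r \<ge> A + B" using that c by (auto simp: r_def \<rho>_def field_simps)
    have "g w \<ge> g z + q \<bullet> (w - z)" using assms(2) by (simp add: subdifferential_def)
    then have "F w - F x \<ge> (g z + q \<bullet> (x - z) - g x) + (q + v) \<bullet> (w - x) + c * r\<^sup>2"
      by (simp add: F_def c_def r_def inner_diff inner_add algebra_simps)
    moreover have "g z + q \<bullet> (x - z) - g x \<ge> - A * 1" by (simp add: A_def)
    moreover have "- A * 1 \<ge> - A * r" using r(1) by (intro mult_left_mono_neg) (auto simp: A_def)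
    moreover have "(q + v) \<bullet> (w - x) \<ge> - (B * r)"
      using Cauchy_Schwarz_ineq2[of "q + v" "w - x"] by (simp add: B_def r_def abs_le_iff)
    moreover have "(c * r) * r \<ge> (A + B) * r" using r by (intro mult_right_mono) auto
    ultimately show ?thesis by (simp add: power2_eq_square algebra_simps)
  qed
  have "\<exists>m\<in>cball x \<rho>. \<forall>w\<in>cball x \<rho>. F m \<le> F w"
    by (rule continuous_attains_inf) (auto simp: \<rho>_def cont)
  then obtain m where m: "\<forall>w\<in>cball x \<rho>. F m \<le> F w" by blast
  have "F m \<le> F w" for w
  proof (cases "norm (w - x) \<le> \<rho>")
    case True
    then show ?thesis using m by (simp add: dist_norm norm_minus_commute)
  next
    case False
    moreover have "F m \<le> F x" using m by (auto simp: \<rho>_def)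
    ultimately show ?thesis using outside[of w] by simp
  qed
  then show ?thesis using that unfolding F_def by blast
qed

lemma prox_minimizer_subgradient:
  fixes g :: "'a::real_inner \<Rightarrow> real"
  assumes "convex_on UNIV g" "\<tau> > 0"
    and min: "\<And>w. g m + v \<bullet> m + 1 / (2 * \<tau>) * (norm (m - x))\<^sup>2 \<le> g w + v \<bullet> w + 1 / (2 * \<tau>) * (norm (w - x))\<^sup>2"
  shows "- (v + (1 / \<tau>) *\<^sub>R (m - x)) \<in> subdifferential g m"
proof -
  have "0 \<le> g w - g m + (v + (1 / \<tau>) *\<^sub>R (m - x)) \<bullet> (w - m)" (is "0 \<le> ?L") for w
  proof -
    define N where "N = 1 / (2 * \<tau>) * (norm (w - m))\<^sup>2"
    \<comment> \<open>Minimality is tested along the segment from \<open>m\<close> to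
      \<open>w\<close>. After division by \<open>s\<close>, convexity and the linear terms leave
      \<open>?L\<close>, and the quadratic remainder \<open>s * N\<close> vanishes as
      \<open>s\<close> tends to 0.\<close>
    have bound: "0 \<le> ?L + s * N" if s: "0 < s" "s < 1" for s
    proof -
      define ws where "ws = (1 - s) *\<^sub>R m + s *\<^sub>R w"
      have "g ws \<le> (1 - s) * g m + s * g w"
        unfolding ws_def using s by (intro convex_onD[OF assms(1)]) auto
      moreover have "v \<bullet> ws = v \<bullet> m + s * (v \<bullet> (w - m))"
        by (simp add: ws_def inner_diff inner_add algebra_simps)
      moreover have "(norm (ws - x))\<^sup>2
          = (norm (m - x))\<^sup>2 + s * (2 * ((m - x) \<bullet> (w - m))) + s * (s * (norm (w - m))\<^sup>2)"
        by (simp add: ws_def power2_norm_eq_inner inner_diff inner_add inner_commute algebra_simps)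
      then have "1 / (2 * \<tau>) * (norm (ws - x))\<^sup>2
          = 1 / (2 * \<tau>) * (norm (m - x))\<^sup>2 + s * (1 / \<tau> * ((m - x) \<bullet> (w - m))) + s * (s * N)"
        using assms(2) by (simp add: N_def field_simps)
      ultimately have "0 \<le> s * (?L + s * N)"
        using min[of ws] by (simp add: inner_add algebra_simps)
      then show ?thesis using s by (simp add: zero_le_mult_iff)
    qed
    have "((\<lambda>s. ?L + s * N) \<longlongrightarrow> ?L + 0 * N) (at_right 0)"
      by (intro tendsto_intros)
    moreover have "eventually (\<lambda>s. 0 \<le> ?L + s * N) (at_right 0)"
      unfolding eventually_at_right_field by (intro exI[of _ 1]) (auto intro: bound)
    ultimately show ?thesis
      using tendsto_lowerbound by fastforce
  qed
  then show ?thesis unfolding subdifferential_def by (simp add: inner_minus_left algebra_simps)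
qed

lemma prox_arg_min_subgradient:
  fixes g :: "'a::euclidean_space \<Rightarrow> real" and v x :: 'a
  assumes "convex_on UNIV g" "q \<in> subdifferential g z" "\<tau> > 0"
  defines "m \<equiv> arg_min (\<lambda>w. g w + v \<bullet> w + 1 / (2 * \<tau>) * (norm (w - x))\<^sup>2) (\<lambda>_. True)"
  shows "- (v + (1 / \<tau>) *\<^sub>R (m - x)) \<in> subdifferential g m"
proof (rule prox_minimizer_subgradient[OF assms(1,3)])
  obtain m0 where "\<And>w. g m0 + v \<bullet> m0 + 1 / (2 * \<tau>) * (norm (m0 - x))\<^sup>2
      \<le> g w + v \<bullet> w + 1 / (2 * \<tau>) * (norm (w - x))\<^sup>2"
    using prox_minimizer_exists[OF assms(1-3), where v = v and x = x] by blast
  then show "g m + v \<bullet> m + 1 / (2 * \<tau>) * (norm (m - x))\<^sup>2 \<le> g w + v \<bullet> w + 1 / (2 * \<tau>) * (norm (w - x))\<^sup>2" for w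
    unfolding m_def by (rule arg_min_le)
qed

section \<open>Independent sampling\<close>

text \<open>Replaces conditioning on the past: \<open>F\<close> depends only on the indices before
  \<open>t\<close>, which are independent of \<open>K t\<close>, so the expectation splits over the
  values of \<open>K t\<close>. Integrability holds because there are finitely many index
  histories.\<close>

lemma expectation_independent_index:
  fixes K :: "nat \<Rightarrow> 'w \<Rightarrow> 'n::finite" and F :: "(nat \<Rightarrow> 'n) \<Rightarrow> 's" and H :: "'n \<Rightarrow> 's \<Rightarrow> real"
  assumes "prob_space M"
    and indep: "prob_space.indep_vars M (\<lambda>_. count_space UNIV) K UNIV"
    and adapted: "\<And>ks ks'. (\<And>r. r < t \<Longrightarrow> ks r = ks' r) \<Longrightarrow> F ks = F ks'"
  shows "integrable M (\<lambda>\<omega>. H (K t \<omega>) (F (\<lambda>r. K r \<omega>)))"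
    and "prob_space.expectation M (\<lambda>\<omega>. H (K t \<omega>) (F (\<lambda>r. K r \<omega>)))
       = (\<Sum>k\<in>UNIV. measure M {\<omega> \<in> space M. K t \<omega> = k} * prob_space.expectation M (\<lambda>\<omega>. H k (F (\<lambda>r. K r \<omega>))))"
proof -
  interpret prob_space M by fact
  have meas: "K r \<in> measurable M (count_space UNIV)" for r
    using indep unfolding indep_vars_def by auto
  let ?I = "\<lambda>k \<omega>. indicator {k} (K t \<omega>) :: real"
  let ?G = "\<lambda>k \<omega>. H k (F (\<lambda>r. K r \<omega>))"
  let ?P = "PiM {..<t} (\<lambda>_. count_space UNIV) :: (nat \<Rightarrow> 'n) measure"
  \<comment> \<open>Both factors are written as functions of the index sequence restricted to the
    disjoint sets \<open>{..<t}\<close> and \<open>{t}\<close>, the form in which independence of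
    restrictions applies.\<close>
  have G_eq: "?G k = (\<lambda>ks. H k (F ks)) \<circ> (\<lambda>\<omega>. restrict (\<lambda>r. K r \<omega>) {..<t})" for k
    by (auto simp: fun_eq_iff intro!: arg_cong[of _ _ "H k"] adapted)
  have I_eq: "?I k = (\<lambda>ks. indicator {k} (ks t)) \<circ> (\<lambda>\<omega>. restrict (\<lambda>r. K r \<omega>) {t})" for k
    by (auto simp: fun_eq_iff)
  \<comment> \<open>A finite product of finite discrete spaces is discrete, so every function of the
    history is measurable.\<close>
  have P_eq: "?P = count_space (PiE {..<t} (\<lambda>_. UNIV))"
    by (rule count_space_PiM_finite) auto
  have ind: "indep_var borel (?I k) borel (?G k)" for k
    unfolding G_eq I_eq
  proof (rule indep_var_compose[OF indep_var_restrict[OF indep]])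
    show "(\<lambda>ks. H k (F ks)) \<in> borel_measurable ?P" unfolding P_eq by simp
    have "(\<lambda>ks. ks t) \<in> measurable (PiM {t} (\<lambda>_. count_space UNIV)) (count_space UNIV)"
      by (rule measurable_component_singleton) simp
    then show "(\<lambda>ks. indicator {k} (ks t) :: real) \<in> borel_measurable (PiM {t} (\<lambda>_. count_space UNIV))"
      by (rule measurable_compose) simp
  qed auto
  have int_I: "integrable M (?I k)" for k
    by (rule integrable_const_bound[of _ 1])
      (auto simp: indicator_def intro!: measurable_compose[OF meas])
  have int_G: "integrable M (?G k)" for k
  proof (rule integrable_const_bound)
    have fin: "finite ((\<lambda>ks. H k (F ks)) ` PiE {..<t} (\<lambda>_. UNIV))"
      by (intro finite_imageI finite_PiE) auto
    show "AE \<omega> in M. norm (?G k \<omega>) \<le> Max (abs ` (\<lambda>ks. H k (F ks)) ` PiE {..<t} (\<lambda>_. UNIV))"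
    proof (rule AE_I2)
      fix \<omega>
      have "?G k \<omega> = H k (F (restrict (\<lambda>r. K r \<omega>) {..<t}))"
        using fun_cong[OF G_eq[of k], of \<omega>] by simp
      then show "norm (?G k \<omega>) \<le> Max (abs ` (\<lambda>ks. H k (F ks)) ` PiE {..<t} (\<lambda>_. UNIV))"
        using fin by (auto simp del: restrict_apply intro!: Max_ge)
    qed
    show "?G k \<in> borel_measurable M"
      using indep_var_rv2[OF ind] .
  qed
  have decomp: "(\<lambda>\<omega>. H (K t \<omega>) (F (\<lambda>r. K r \<omega>))) = (\<lambda>\<omega>. \<Sum>k\<in>UNIV. ?I k \<omega> * ?G k \<omega>)"
    by (auto simp: fun_eq_iff indicator_def)
  note int = indep_var_integrable[OF ind int_I int_G]
  show "integrable M (\<lambda>\<omega>. H (K t \<omega>) (F (\<lambda>r. K r \<omega>)))"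
    unfolding decomp using int by (rule Bochner_Integration.integrable_sum)
  have "expectation (?I k) = prob {\<omega> \<in> space M. K t \<omega> = k}" for k
  proof -
    have "expectation (?I k) = expectation (indicator {\<omega> \<in> space M. K t \<omega> = k})"
      by (rule Bochner_Integration.integral_cong) (auto simp: indicator_def)
    also have "\<dots> = prob {\<omega> \<in> space M. K t \<omega> = k}"
      by (auto intro!: arg_cong[of _ _ prob])
    finally show ?thesis .
  qed
  then show "expectation (\<lambda>\<omega>. H (K t \<omega>) (F (\<lambda>r. K r \<omega>)))
      = (\<Sum>k\<in>UNIV. prob {\<omega> \<in> space M. K t \<omega> = k} * expectation (?G k))"
    using int unfolding decomp Bochner_Integration.integral_sum[OF int]
    by (simp only: indep_var_lebesgue_integral[OF ind int_I int_G])
qed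

text \<open>Supplies the hypothesis \<open>adapted\<close> of
  \<open>expectation_independent_index\<close> for the iterates.\<close>

lemma spdc_cong:
  assumes "\<And>r. r < t \<Longrightarrow> ks r = ks' r"
  shows "spdc a \<phi> g \<alpha> \<tau> \<sigma> \<theta> x\<^sub>0 y\<^sub>0 ks t = spdc a \<phi> g \<alpha> \<tau> \<sigma> \<theta> x\<^sub>0 y\<^sub>0 ks' t"
  using assms by (induction t) auto

section \<open>Contraction of the potential\<close>

locale spdc_analysis =
  fixes a :: "'n::finite \<Rightarrow> real ^ 'd"
    and \<phi> :: "'n \<Rightarrow> real \<Rightarrow> real"
    and g :: "real ^ 'd \<Rightarrow> real"
    and \<gamma> \<mu> \<alpha> \<tau> \<sigma> \<theta> R n :: real
    and x\<^sub>s :: "real ^ 'd" and y\<^sub>s :: "real ^ 'n"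
  assumes smooth: "\<And>i. smooth_convex (\<phi> i) \<gamma>"
    and gamma_pos: "\<gamma> > 0" and mu_pos: "\<mu> > 0" and alpha: "0 < \<alpha>" "\<alpha> < 1"
    and g_sc: "strongly_convex \<mu> g"
    and n_eq: "n = real CARD('n)"
    and R_eq: "R = 1 / n * (\<Sum>i\<in>UNIV. norm (a i))"
    and R_pos: "R > 0"
    and saddle: "saddle_point (lagrangian a \<phi> g) x\<^sub>s y\<^sub>s"
    and tau_eq: "\<tau> = \<alpha> / (2 * R) * sqrt (\<gamma> / (n * \<mu>))"
    and sigma_eq: "\<sigma> = \<alpha> / (2 * R) * sqrt (n * \<mu> / \<gamma>)"
    and theta_eq: "\<theta> = 1 - inverse (n / (1 - \<alpha>) + R / \<alpha> * sqrt (n / (\<mu> * \<gamma>)))"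
begin

abbreviation p :: "'n \<Rightarrow> real" where "p \<equiv> sampling_prob \<alpha> a"

section \<open>Sampling probabilities, step sizes and rate\<close>

lemma n_ge1: "n \<ge> 1"
  unfolding n_eq using zero_less_card_finite[where 'a='n] by linarith

lemma sum_norm: "(\<Sum>i\<in>UNIV. norm (a i)) = n * R"
  using R_eq n_ge1 by (simp add: field_simps)

lemma p_eq: "p k = (1 - \<alpha>) / n + \<alpha> * norm (a k) / (n * R)"
  by (simp add: sampling_prob_def sum_norm n_eq)

lemma p_ge: "p k \<ge> (1 - \<alpha>) / n"
  unfolding p_eq using alpha R_pos n_ge1 by simp

lemma p_pos: "p k > 0"
  using p_ge[of k] alpha n_ge1 by (smt (verit) divide_pos_pos)

lemma sum_p: "(\<Sum>k\<in>UNIV. p k) = 1"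
proof -
  have "(\<Sum>k\<in>UNIV. p k) = n * ((1 - \<alpha>) / n) + \<alpha> * (n * R) / (n * R)"
    unfolding p_eq sum.distrib sum_divide_distrib[symmetric] sum_distrib_left[symmetric] sum_norm
    by (simp add: n_eq)
  then show ?thesis using R_pos n_ge1 by simp
qed

lemma p_le1: "p k \<le> 1"
  using member_le_sum[of k UNIV p] p_pos sum_p by (simp add: less_imp_le)

text \<open>The purpose of the norm-weighted share of the sampling: it makes \<open>n * p k\<close>
  at least \<open>\<alpha> * norm (a k) / R\<close>, a bound on the amplified updates that is
  uniform in \<open>k\<close>.\<close>

lemma norm_a_le: "norm (a k) / (n * p k) \<le> R / \<alpha>"
proof -
  have "\<alpha> * norm (a k) \<le> R * (n * p k)"
    unfolding p_eq using alpha R_pos n_ge1 by (simp add: field_simps)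
  then show ?thesis using p_pos[of k] alpha n_ge1 by (simp add: field_simps)
qed

lemma tau_pos: "\<tau> > 0" and sigma_pos: "\<sigma> > 0"
  using tau_eq sigma_eq alpha R_pos gamma_pos mu_pos n_ge1 by auto

lemma tau_sigma: "\<tau> * (R / \<alpha>)\<^sup>2 = 1 / (4 * \<sigma>)"
proof -
  have "sqrt (\<gamma> / (n * \<mu>)) * sqrt (n * \<mu> / \<gamma>) = 1"
    using gamma_pos mu_pos n_ge1 by (simp add: real_sqrt_mult[symmetric])
  moreover have "\<tau> * \<sigma> = (\<alpha> / (2 * R))\<^sup>2 * (sqrt (\<gamma> / (n * \<mu>)) * sqrt (n * \<mu> / \<gamma>))"
    unfolding tau_eq sigma_eq by (simp add: power2_eq_square)
  ultimately have "\<tau> * \<sigma> = (\<alpha> / (2 * R))\<^sup>2" by simp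
  then show ?thesis using sigma_pos R_pos alpha by (simp add: field_simps power2_eq_square)
qed

text \<open>The step sizes balance the primal and dual ratios, both of which equal the second
  summand in the denominator of \<open>1 - \<theta>\<close>.\<close>

lemma rate_params:
  "1 / (2 * \<tau> * \<mu>) = R / \<alpha> * sqrt (n / (\<mu> * \<gamma>))"
  "n / (2 * \<sigma> * \<gamma>) = R / \<alpha> * sqrt (n / (\<mu> * \<gamma>))"
proof -
  have pos: "\<gamma> > 0" "\<mu> > 0" "n > 0" using gamma_pos mu_pos n_ge1 by auto
  define sg sm sn where "sg = sqrt \<gamma>" "sm = sqrt \<mu>" "sn = sqrt n"
  have s: "\<gamma> = sg\<^sup>2" "\<mu> = sm\<^sup>2" "n = sn\<^sup>2" "sg > 0" "sm > 0" "sn > 0"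
    using pos by (auto simp: sg_sm_sn_def)
  show "1 / (2 * \<tau> * \<mu>) = R / \<alpha> * sqrt (n / (\<mu> * \<gamma>))"
    "n / (2 * \<sigma> * \<gamma>) = R / \<alpha> * sqrt (n / (\<mu> * \<gamma>))"
    unfolding tau_eq sigma_eq real_sqrt_divide real_sqrt_mult
    unfolding sg_sm_sn_def[symmetric] s using s(4-6) R_pos alpha
    by (auto simp: field_simps power2_eq_square)
qed

lemma rate_denom: "n / (1 - \<alpha>) + R / \<alpha> * sqrt (n / (\<mu> * \<gamma>)) > 1"
proof -
  have "n / (1 - \<alpha>) > 1" using alpha n_ge1 by (simp add: field_simps)
  moreover have "R / \<alpha> * sqrt (n / (\<mu> * \<gamma>)) \<ge> 0"
    using R_pos alpha n_ge1 mu_pos gamma_pos by simp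
  ultimately show ?thesis by linarith
qed

lemma theta_pos: "\<theta> > 0" and theta_le1: "\<theta> \<le> 1"
  unfolding theta_eq using rate_denom
  by (auto simp: inverse_less_1_iff)

text \<open>After subtraction and division by \<open>\<mu>\<close> this is
  \<open>1 + 1 / (2 * \<tau> * \<mu>) \<le> D\<close>, where 1 is bounded by
  \<open>n / (1 - \<alpha>)\<close>.\<close>

lemma theta_primal: "1 / (2 * \<tau>) \<le> \<theta> * (1 / (2 * \<tau>) + \<mu>)"
proof -
  define D where "D = n / (1 - \<alpha>) + R / \<alpha> * sqrt (n / (\<mu> * \<gamma>))"
  have D: "D > 1" "\<theta> = 1 - inverse D" using rate_denom theta_eq by (auto simp: D_def)
  have "n / (1 - \<alpha>) \<ge> 1" using alpha n_ge1 by (simp add: field_simps)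
  then have "1 + 1 / (2 * \<tau> * \<mu>) \<le> D" unfolding rate_params D_def by simp
  then have "\<mu> * (1 + 1 / (2 * \<tau> * \<mu>)) \<le> \<mu> * D" using mu_pos by simp
  moreover have "\<mu> * (1 + 1 / (2 * \<tau> * \<mu>)) = 1 / (2 * \<tau>) + \<mu>"
    using mu_pos tau_pos by (simp add: field_simps)
  ultimately have "inverse D * (1 / (2 * \<tau>) + \<mu>) \<le> \<mu>"
    using D by (simp add: field_simps)
  then show ?thesis unfolding D(2) left_diff_distrib by simp
qed

text \<open>The weight of the new dual error in the proximal inequality of coordinate
  \<open>i\<close> once that inequality is divided by \<open>n * p i\<close>.\<close>

definition w :: "'n \<Rightarrow> real" where "w i = 1 / (2 * \<sigma>) + \<gamma> / (p i * n)"

text \<open>Equivalent to \<open>1 / p i + n / (2 * \<sigma> * \<gamma>) \<le> D\<close>; the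
  uniform share of the sampling gives \<open>1 / p i \<le> n / (1 - \<alpha>)\<close>.\<close>

lemma theta_dual: "w i - \<gamma> / n \<le> \<theta> * w i"
proof -
  define D where "D = n / (1 - \<alpha>) + R / \<alpha> * sqrt (n / (\<mu> * \<gamma>))"
  have D: "D > 1" "\<theta> = 1 - inverse D" using rate_denom theta_eq by (auto simp: D_def)
  have "1 / p i \<le> 1 / ((1 - \<alpha>) / n)"
    using p_ge[of i] p_pos[of i] alpha n_ge1 by (intro divide_left_mono) auto
  then have "1 / p i + n / (2 * \<sigma> * \<gamma>) \<le> D" unfolding rate_params D_def by simp
  then have "\<gamma> / n * (1 / p i + n / (2 * \<sigma> * \<gamma>)) \<le> \<gamma> / n * D"
    using gamma_pos n_ge1 by (intro mult_left_mono) auto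
  moreover have "\<gamma> / n * (1 / p i + n / (2 * \<sigma> * \<gamma>)) = w i"
    using gamma_pos sigma_pos n_ge1 p_pos[of i] by (simp add: w_def field_simps)
  ultimately have "inverse D * w i \<le> \<gamma> / n"
    using D by (simp add: field_simps)
  then show ?thesis unfolding D(2) left_diff_distrib by simp
qed

section \<open>Optimality conditions at the saddle point\<close>

definition u\<^sub>s :: "real ^ 'd" where "u\<^sub>s = (1 / n) *\<^sub>R (\<Sum>i\<in>UNIV. (y\<^sub>s $ i) *\<^sub>R a i)"

definition gap :: "'n \<Rightarrow> real \<Rightarrow> ereal" where
  "gap i b = ereal (b * (a i \<bullet> x\<^sub>s)) - convex_conjugate (\<phi> i) b"

lemma saddle_conjugate_finite: "\<bar>convex_conjugate (\<phi> i) (y\<^sub>s $ i)\<bar> \<noteq> \<infinity>"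
proof -
  define z where "z i = a i \<bullet> x\<^sub>s" for i
  \<comment> \<open>A competitor whose conjugates are finite by \<open>conjugate_deriv\<close>.
    Since the saddle value is at least as large, it is not \<open>-\<infinity>\<close>; one infinite
    conjugate would make it so, as no summand is \<open>\<infinity>\<close>.\<close>
  define y\<^sub>1 :: "real ^ 'n" where "y\<^sub>1 = (\<chi> i. deriv (\<phi> i) (z i))"
  have conj1: "convex_conjugate (\<phi> i) (y\<^sub>1 $ i) = ereal (z i * y\<^sub>1 $ i - \<phi> i (z i))" for i
    by (simp add: y\<^sub>1_def smooth_convex.conjugate_deriv[OF smooth])
  have "lagrangian a \<phi> g x\<^sub>s y\<^sub>1 \<noteq> -\<infinity>"
    unfolding lagrangian_def conj1 by simp
  moreover have "lagrangian a \<phi> g x\<^sub>s y\<^sub>1 \<le> lagrangian a \<phi> g x\<^sub>s y\<^sub>s"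
    using saddle unfolding saddle_point_def by blast
  ultimately have ne: "lagrangian a \<phi> g x\<^sub>s y\<^sub>s \<noteq> -\<infinity>" by auto
  show ?thesis
  proof
    assume "\<bar>convex_conjugate (\<phi> i) (y\<^sub>s $ i)\<bar> = \<infinity>"
    then have "convex_conjugate (\<phi> i) (y\<^sub>s $ i) = \<infinity>"
      using smooth_convex.conjugate_ne_minf[OF smooth, of i "y\<^sub>s $ i"] by auto
    then have inf: "gap i (y\<^sub>s $ i) = -\<infinity>" by (simp add: gap_def)
    have "gap j (y\<^sub>s $ j) \<noteq> \<infinity>" for j
      using smooth_convex.conjugate_ne_minf[OF smooth, of j "y\<^sub>s $ j"]
      by (cases "convex_conjugate (\<phi> j) (y\<^sub>s $ j)") (auto simp: gap_def)
    then have "(\<Sum>j\<in>UNIV. gap j (y\<^sub>s $ j)) = -\<infinity>"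
      using inf by (subst sum.remove[of _ i]) (auto simp: sum_Pinfty)
    then have "lagrangian a \<phi> g x\<^sub>s y\<^sub>s = -\<infinity>"
      using n_ge1 by (simp add: lagrangian_def gap_def)
    then show False using ne by simp
  qed
qed

text \<open>At \<open>x\<^sub>s\<close> the dual objective is separable, and by
  \<open>conjugate_lower\<close> each coordinate loses at least a multiple of its squared distance
  to the slope. Since the saddle point maximizes the sum, all these distances vanish.\<close>

lemma saddle_dual: "y\<^sub>s $ i = deriv (\<phi> i) (a i \<bullet> x\<^sub>s)"
proof -
  define z where "z i = a i \<bullet> x\<^sub>s" for i
  define y\<^sub>1 :: "real ^ 'n" where "y\<^sub>1 = (\<chi> i. deriv (\<phi> i) (z i))"
  define c where "c i = real_of_ereal (convex_conjugate (\<phi> i) (y\<^sub>s $ i))" for i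
  have conj1: "convex_conjugate (\<phi> i) (y\<^sub>1 $ i) = ereal (z i * y\<^sub>1 $ i - \<phi> i (z i))" for i
    by (simp add: y\<^sub>1_def smooth_convex.conjugate_deriv[OF smooth])
  have conjs: "convex_conjugate (\<phi> i) (y\<^sub>s $ i) = ereal (c i)" for i
    unfolding c_def using saddle_conjugate_finite[of i] by (simp add: ereal_real)
  have low: "c i \<ge> z i * y\<^sub>s $ i - \<phi> i (z i) + \<gamma> / 2 * (y\<^sub>s $ i - y\<^sub>1 $ i)\<^sup>2" for i
    using smooth_convex.conjugate_lower[OF smooth, of "z i" "y\<^sub>s $ i" i] conjs[of i]
    by (simp add: y\<^sub>1_def)
  have "lagrangian a \<phi> g x\<^sub>s y\<^sub>1 \<le> lagrangian a \<phi> g x\<^sub>s y\<^sub>s"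
    using saddle unfolding saddle_point_def by blast
  then have "1 / n * (\<Sum>i\<in>UNIV. y\<^sub>1 $ i * z i - (z i * y\<^sub>1 $ i - \<phi> i (z i)))
      \<le> 1 / n * (\<Sum>i\<in>UNIV. y\<^sub>s $ i * z i - c i)"
    by (simp add: lagrangian_def conj1 conjs n_eq z_def[symmetric])
  then have "(\<Sum>i\<in>UNIV. y\<^sub>1 $ i * z i - (z i * y\<^sub>1 $ i - \<phi> i (z i))) \<le> (\<Sum>i\<in>UNIV. y\<^sub>s $ i * z i - c i)"
    using n_ge1 by (simp add: divide_le_cancel)
  also have "\<dots> \<le> (\<Sum>i\<in>UNIV. \<phi> i (z i) - \<gamma> / 2 * (y\<^sub>s $ i - y\<^sub>1 $ i)\<^sup>2)"
    using low by (intro sum_mono) (simp add: algebra_simps)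
  finally have "(\<Sum>i\<in>UNIV. \<gamma> / 2 * (y\<^sub>s $ i - y\<^sub>1 $ i)\<^sup>2) \<le> 0"
    by (simp add: sum_subtractf mult.commute)
  moreover have "\<gamma> / 2 * (y\<^sub>s $ i - y\<^sub>1 $ i)\<^sup>2 \<le> (\<Sum>i\<in>UNIV. \<gamma> / 2 * (y\<^sub>s $ i - y\<^sub>1 $ i)\<^sup>2)"
    using gamma_pos by (intro member_le_sum) auto
  ultimately have "\<gamma> / 2 * (y\<^sub>s $ i - y\<^sub>1 $ i)\<^sup>2 \<le> 0" by linarith
  then have "y\<^sub>s $ i = y\<^sub>1 $ i" using gamma_pos by (simp add: mult_le_0_iff)
  then show ?thesis by (simp add: y\<^sub>1_def z_def)
qed

text \<open>With finite conjugates the Lagrangian at \<open>y\<^sub>s\<close> is \<open>g\<close>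
  plus the linear form of \<open>u\<^sub>s\<close> plus a constant, and \<open>x\<^sub>s\<close>
  minimizes it.\<close>

lemma saddle_primal: "- u\<^sub>s \<in> subdifferential g x\<^sub>s"
proof -
  define c where "c i = real_of_ereal (convex_conjugate (\<phi> i) (y\<^sub>s $ i))" for i
  have conjs: "convex_conjugate (\<phi> i) (y\<^sub>s $ i) = ereal (c i)" for i
    unfolding c_def using saddle_conjugate_finite[of i] by (simp add: ereal_real)
  have val: "lagrangian a \<phi> g v y\<^sub>s = ereal (u\<^sub>s \<bullet> v - 1 / n * (\<Sum>i\<in>UNIV. c i) + g v)" for v
    by (simp add: lagrangian_def conjs n_eq[symmetric] u\<^sub>s_def sum_subtractf inner_sum_left
        right_diff_distrib diff_divide_distrib)
  have "lagrangian a \<phi> g x\<^sub>s y\<^sub>s \<le> lagrangian a \<phi> g v y\<^sub>s" for v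
    using saddle unfolding saddle_point_def by blast
  then have "g x\<^sub>s + u\<^sub>s \<bullet> x\<^sub>s \<le> g v + u\<^sub>s \<bullet> v" for v
    unfolding val by (simp add: algebra_simps)
  then show ?thesis by (simp add: subdifferential_def inner_diff_right algebra_simps)
qed

section \<open>Inequalities for a single dual and primal update\<close>

lemma dual_step_bound:
  assumes b: "b = deriv (\<phi> k) z" "z = s - c * (b - b\<^sub>0)"
  shows "(c / 2 + \<gamma>) * (b - y\<^sub>s $ k)\<^sup>2 + c / 2 * (b - b\<^sub>0)\<^sup>2 - (s - a k \<bullet> x\<^sub>s) * (b - y\<^sub>s $ k)
    \<le> c / 2 * (b\<^sub>0 - y\<^sub>s $ k)\<^sup>2"
proof -
  define e where "e = y\<^sub>s $ k"
  \<comment> \<open>By \<open>saddle_dual\<close>, \<open>b\<close> and \<open>e\<close> are the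
    slopes of \<open>\<phi> k\<close> at \<open>z\<close> and at
    \<open>a k \<bullet> x\<^sub>s\<close>, so cocoercivity compares them directly.\<close>
  have "\<gamma> * (b - e)\<^sup>2 \<le> (z - a k \<bullet> x\<^sub>s) * (b - e)"
    using smooth_convex.cocoercive[OF smooth, of k z "a k \<bullet> x\<^sub>s"]
    by (simp add: b(1)[symmetric] saddle_dual[symmetric] e_def)
  also have "\<dots> = (s - a k \<bullet> x\<^sub>s) * (b - e) + c / 2 * (b\<^sub>0 - e)\<^sup>2 - c / 2 * (b - e)\<^sup>2 - c / 2 * (b - b\<^sub>0)\<^sup>2"
    unfolding b(2) by (simp add: power2_eq_square field_simps)
  finally show ?thesis unfolding e_def by (simp add: algebra_simps)
qed

text \<open>Strong monotonicity between the subgradients at \<open>m\<close> and at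
  \<open>x\<^sub>s\<close>, followed by expanding the square of
  \<open>x - x\<^sub>s = (m - x\<^sub>s) - (m - x)\<close>.\<close>

lemma primal_step_bound:
  assumes "- (v + (1 / \<tau>) *\<^sub>R (m - x)) \<in> subdifferential g m"
  shows "(1 / (2 * \<tau>) + \<mu>) * (norm (m - x\<^sub>s))\<^sup>2 + 1 / (2 * \<tau>) * (norm (m - x))\<^sup>2 + (v - u\<^sub>s) \<bullet> (m - x\<^sub>s)
    \<le> 1 / (2 * \<tau>) * (norm (x - x\<^sub>s))\<^sup>2"
proof -
  define A B where "A = m - x\<^sub>s" and "B = m - x"
  have "\<mu> * (norm A)\<^sup>2 \<le> - ((v - u\<^sub>s) \<bullet> A) - 1 / \<tau> * (B \<bullet> A)"
    using strongly_convex_monotone[OF g_sc assms saddle_primal]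
    by (simp add: A_def[symmetric] B_def[symmetric] inner_diff_left inner_add_left)
  moreover have diff: "x - x\<^sub>s = A - B" by (simp add: A_def B_def)
  have nsq: "(norm (x - x\<^sub>s))\<^sup>2 = (norm A)\<^sup>2 + (norm B)\<^sup>2 - 2 * (B \<bullet> A)"
    unfolding diff by (simp add: power2_norm_eq_inner inner_diff inner_commute algebra_simps)
  have "1 / (2 * \<tau>) * (norm (x - x\<^sub>s))\<^sup>2
      = 1 / (2 * \<tau>) * (norm A)\<^sup>2 + 1 / (2 * \<tau>) * (norm B)\<^sup>2 - 1 / \<tau> * (B \<bullet> A)"
    unfolding nsq using tau_pos by (simp add: field_simps)
  ultimately show ?thesis unfolding A_def[symmetric] B_def[symmetric]
    by (simp add: algebra_simps)
qed

lemma spdc_step_bounds: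
  obtains b m where
    "spdc_step a \<phi> g \<alpha> \<tau> \<sigma> \<theta> k (x, y, u, x\<^sub>b)
      = (m, (\<chi> i. if i = k then b else y $ i), u + (1 / n * (b - y $ k)) *\<^sub>R a k, m + \<theta> *\<^sub>R (m - x))"
    "w k * (b - y\<^sub>s $ k)\<^sup>2 + 1 / (2 * \<sigma>) * (b - y $ k)\<^sup>2
        - 1 / (n * p k) * (a k \<bullet> (x\<^sub>b - x\<^sub>s)) * (b - y\<^sub>s $ k) \<le> 1 / (2 * \<sigma>) * (y $ k - y\<^sub>s $ k)\<^sup>2"
    "(1 / (2 * \<tau>) + \<mu>) * (norm (m - x\<^sub>s))\<^sup>2 + 1 / (2 * \<tau>) * (norm (m - x))\<^sup>2
        + (u + (1 / p k) *\<^sub>R ((1 / n * (b - y $ k)) *\<^sub>R a k) - u\<^sub>s) \<bullet> (m - x\<^sub>s)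
      \<le> 1 / (2 * \<tau>) * (norm (x - x\<^sub>s))\<^sup>2"
proof -
  \<comment> \<open>Chosen so that \<open>c / 2\<close> is the proximal coefficient; dividing by
    \<open>n * p k\<close> later turns it into \<open>1 / (2 * \<sigma>)\<close>.\<close>
  define c where "c = p k * n / \<sigma>"
  have c: "c > 0" using p_pos n_ge1 sigma_pos by (simp add: c_def)
  define b where "b = arg_max (\<lambda>\<beta>. ereal (\<beta> * (a k \<bullet> x\<^sub>b)) - convex_conjugate (\<phi> k) \<beta>
      - ereal (p k * n / (2 * \<sigma>) * (\<beta> - y $ k)\<^sup>2)) (\<lambda>_. True)"
  define v where "v = u + (1 / p k) *\<^sub>R ((1 / n * (b - y $ k)) *\<^sub>R a k)"
  define m where "m = arg_min (\<lambda>w. g w + v \<bullet> w + 1 / (2 * \<tau>) * (norm (w - x))\<^sup>2) (\<lambda>_. True)"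
  have y_upd: "(\<chi> i. if i = k then arg_max (\<lambda>\<beta>. ereal (\<beta> * (a i \<bullet> x\<^sub>b)) - convex_conjugate (\<phi> i) \<beta>
      - ereal (p i * n / (2 * \<sigma>) * (\<beta> - y $ i)\<^sup>2)) (\<lambda>_. True) else y $ i) = (\<chi> i. if i = k then b else y $ i)"
    by (simp add: b_def vec_eq_iff)
  have step: "spdc_step a \<phi> g \<alpha> \<tau> \<sigma> \<theta> k (x, y, u, x\<^sub>b)
      = (m, (\<chi> i. if i = k then b else y $ i), u + (1 / n * (b - y $ k)) *\<^sub>R a k, m + \<theta> *\<^sub>R (m - x))"
    unfolding spdc_step_def n_eq[symmetric] Let_def prod.case y_upd by (simp add: m_def v_def)
  have b_eq: "b = arg_max (\<lambda>\<beta>. ereal (\<beta> * (a k \<bullet> x\<^sub>b)) - convex_conjugate (\<phi> k) \<beta>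
      - ereal (c / 2 * (\<beta> - y $ k)\<^sup>2)) (\<lambda>_. True)"
    unfolding b_def c_def by (simp add: mult.commute)
  obtain z where "b = deriv (\<phi> k) z" "z = a k \<bullet> x\<^sub>b - c * (deriv (\<phi> k) z - y $ k)"
    using smooth_convex.prox_arg_max[OF smooth[of k] c, where s = "a k \<bullet> x\<^sub>b" and b = "y $ k", folded b_eq]
    by blast
  then have "b = deriv (\<phi> k) z" "z = a k \<bullet> x\<^sub>b - c * (b - y $ k)" by simp_all
  from dual_step_bound[OF this]
  have "1 / (n * p k) * ((c / 2 + \<gamma>) * (b - y\<^sub>s $ k)\<^sup>2 + c / 2 * (b - y $ k)\<^sup>2
        - (a k \<bullet> x\<^sub>b - a k \<bullet> x\<^sub>s) * (b - y\<^sub>s $ k))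
      \<le> 1 / (n * p k) * (c / 2 * (y $ k - y\<^sub>s $ k)\<^sup>2)"
    using p_pos[of k] n_ge1 by (intro mult_left_mono) auto
  moreover have "1 / (n * p k) * (c / 2 * r) = 1 / (2 * \<sigma>) * r" for r
    using p_pos[of k] n_ge1 by (simp add: c_def)
  moreover have "1 / (n * p k) * ((c / 2 + \<gamma>) * r) = w k * r" for r
    using p_pos[of k] n_ge1 sigma_pos by (simp add: c_def w_def field_simps)
  moreover have "1 / (n * p k) * (A + B - C * D)
      = 1 / (n * p k) * A + 1 / (n * p k) * B - 1 / (n * p k) * C * D" for A B C D
    by (simp only: right_diff_distrib distrib_left mult.assoc)
  ultimately have dual: "w k * (b - y\<^sub>s $ k)\<^sup>2 + 1 / (2 * \<sigma>) * (b - y $ k)\<^sup>2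
        - 1 / (n * p k) * (a k \<bullet> (x\<^sub>b - x\<^sub>s)) * (b - y\<^sub>s $ k) \<le> 1 / (2 * \<sigma>) * (y $ k - y\<^sub>s $ k)\<^sup>2"
    by (simp only: inner_diff_right)
  have "convex_on UNIV g" using g_sc by (simp add: strongly_convex_def)
  from prox_arg_min_subgradient[OF this saddle_primal tau_pos, of v x]
  have "- (v + (1 / \<tau>) *\<^sub>R (m - x)) \<in> subdifferential g m" by (simp only: m_def)
  from primal_step_bound[OF this] show ?thesis
    using that[OF step dual] by (simp add: v_def)
qed

text \<open>Since the extrapolated point is \<open>x + \<theta> (x - x\<^sub>p)\<close> with \<open>x\<^sub>p\<close> the previous primal iterate, the
  last primal increment is recovered from the state as \<open>(x\<^sub>b - x) / \<theta>\<close>.\<close>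

definition increment :: "('n, 'd) spdc_state \<Rightarrow> real ^ 'd" where
  "increment = (\<lambda>(x, y, u, x\<^sub>b). (1 / \<theta>) *\<^sub>R (x\<^sub>b - x))"

definition potential :: "('n, 'd) spdc_state \<Rightarrow> real" where
  "potential S = (case S of (x, y, u, x\<^sub>b) \<Rightarrow>
     (1 / (2 * \<tau>) + \<mu>) * (norm (x - x\<^sub>s))\<^sup>2 + (\<Sum>i\<in>UNIV. w i * (y $ i - y\<^sub>s $ i)\<^sup>2)
     + (u - u\<^sub>s) \<bullet> increment S + 1 / (4 * \<tau>) * (norm (increment S))\<^sup>2)"

text \<open>The state type leaves \<open>u\<close> free; this invariant ties it to the dual
  iterate.\<close>

definition consistent :: "('n, 'd) spdc_state \<Rightarrow> bool" where
  "consistent = (\<lambda>(x, y, u, x\<^sub>b). u = (1 / n) *\<^sub>R (\<Sum>i\<in>UNIV. (y $ i) *\<^sub>R a i))"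

section \<open>Contraction in one step\<close>

lemma young:
  fixes e :: real
  assumes "\<bar>q\<bar> \<le> R / \<alpha> * \<bar>e\<bar> * norm d"
  shows "q \<le> 1 / (4 * \<tau>) * (norm d)\<^sup>2 + 1 / (4 * \<sigma>) * e\<^sup>2"
proof -
  define r where "r = R / \<alpha> * \<bar>e\<bar>"
  \<comment> \<open>The square is completed so that the leftover \<open>\<tau> * r\<^sup>2\<close>
    is exactly the dual term, by \<open>tau_sigma\<close>.\<close>
  have "0 \<le> 1 / (4 * \<tau>) * (norm d - 2 * \<tau> * r)\<^sup>2" using tau_pos by simp
  also have "\<dots> = 1 / (4 * \<tau>) * (norm d)\<^sup>2 + \<tau> * r\<^sup>2 - r * norm d"
    using tau_pos by (simp add: power2_eq_square field_simps)
  also have "\<tau> * r\<^sup>2 = \<tau> * (R / \<alpha>)\<^sup>2 * e\<^sup>2"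
    by (simp add: r_def power_mult_distrib power_divide)
  also have "\<dots> = 1 / (4 * \<sigma>) * e\<^sup>2" unfolding tau_sigma ..
  finally show ?thesis using assms unfolding r_def by linarith
qed

text \<open>For a fixed index the new iterates are eliminated, leaving a bound in the old state that
  can be averaged over \<open>k\<close>.\<close>

lemma potential_step_le:
  fixes x x\<^sub>b u :: "real ^ 'd" and y :: "real ^ 'n"
  defines "d \<equiv> increment (x, y, u, x\<^sub>b)"
  shows "potential (spdc_step a \<phi> g \<alpha> \<tau> \<sigma> \<theta> k (x, y, u, x\<^sub>b))
    \<le> 1 / (2 * \<tau>) * (norm (x - x\<^sub>s))\<^sup>2 + (\<Sum>i\<in>UNIV. w i * (y $ i - y\<^sub>s $ i)\<^sup>2)
      - \<gamma> / (p k * n) * (y $ k - y\<^sub>s $ k)\<^sup>2 + \<theta> * (1 / (4 * \<tau>) * (norm d)\<^sup>2)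
      - (u - u\<^sub>s) \<bullet> (x - x\<^sub>s) + 1 / (n * p k) * (y $ k - y\<^sub>s $ k) * (a k \<bullet> (x\<^sub>b - x\<^sub>s))"
proof -
  obtain b m where
    step: "spdc_step a \<phi> g \<alpha> \<tau> \<sigma> \<theta> k (x, y, u, x\<^sub>b)
      = (m, (\<chi> i. if i = k then b else y $ i), u + (1 / n * (b - y $ k)) *\<^sub>R a k, m + \<theta> *\<^sub>R (m - x))"
    and dual: "w k * (b - y\<^sub>s $ k)\<^sup>2 + 1 / (2 * \<sigma>) * (b - y $ k)\<^sup>2
        - 1 / (n * p k) * (a k \<bullet> (x\<^sub>b - x\<^sub>s)) * (b - y\<^sub>s $ k) \<le> 1 / (2 * \<sigma>) * (y $ k - y\<^sub>s $ k)\<^sup>2"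
    and primal: "(1 / (2 * \<tau>) + \<mu>) * (norm (m - x\<^sub>s))\<^sup>2 + 1 / (2 * \<tau>) * (norm (m - x))\<^sup>2
        + (u + (1 / p k) *\<^sub>R ((1 / n * (b - y $ k)) *\<^sub>R a k) - u\<^sub>s) \<bullet> (m - x\<^sub>s)
      \<le> 1 / (2 * \<tau>) * (norm (x - x\<^sub>s))\<^sup>2"
    by (rule spdc_step_bounds)
  define e \<eta> \<kappa> D where "e = b - y $ k" and "\<eta> = y $ k - y\<^sub>s $ k" and "\<kappa> = 1 / (n * p k)" and "D = m - x"
  have \<kappa>: "\<kappa> > 0" "p k * \<kappa> = 1 / n" using p_pos[of k] n_ge1 by (auto simp: \<kappa>_def)
  have xb: "x\<^sub>b = x + \<theta> *\<^sub>R d" using theta_pos by (simp add: d_def increment_def)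
  have "(\<Sum>i\<in>UNIV. w i * ((\<chi> i. if i = k then b else y $ i) $ i - y\<^sub>s $ i)\<^sup>2)
      = w k * (b - y\<^sub>s $ k)\<^sup>2 + (\<Sum>i\<in>UNIV - {k}. w i * (y $ i - y\<^sub>s $ i)\<^sup>2)"
    by (subst sum.remove[of _ k]) auto
  moreover have "(\<Sum>i\<in>UNIV. w i * (y $ i - y\<^sub>s $ i)\<^sup>2)
      = w k * \<eta>\<^sup>2 + (\<Sum>i\<in>UNIV - {k}. w i * (y $ i - y\<^sub>s $ i)\<^sup>2)"
    unfolding \<eta>_def by (rule sum.remove) auto
  ultimately have sum_eq: "(\<Sum>i\<in>UNIV. w i * ((\<chi> i. if i = k then b else y $ i) $ i - y\<^sub>s $ i)\<^sup>2)
      = w k * (b - y\<^sub>s $ k)\<^sup>2 + (\<Sum>i\<in>UNIV. w i * (y $ i - y\<^sub>s $ i)\<^sup>2) - w k * \<eta>\<^sup>2" by simp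
  have "increment (m, (\<chi> i. if i = k then b else y $ i), u + (1 / n * (b - y $ k)) *\<^sub>R a k, m + \<theta> *\<^sub>R (m - x)) = D"
    using theta_pos by (simp add: increment_def D_def)
  then have pot: "potential (spdc_step a \<phi> g \<alpha> \<tau> \<sigma> \<theta> k (x, y, u, x\<^sub>b))
    = (1 / (2 * \<tau>) + \<mu>) * (norm (m - x\<^sub>s))\<^sup>2
      + (w k * (b - y\<^sub>s $ k)\<^sup>2 + (\<Sum>i\<in>UNIV. w i * (y $ i - y\<^sub>s $ i)\<^sup>2) - w k * \<eta>\<^sup>2)
      + (u + (e / n) *\<^sub>R a k - u\<^sub>s) \<bullet> D + 1 / (4 * \<tau>) * (norm D)\<^sup>2"
    unfolding step potential_def by (simp add: sum_eq[simplified] e_def)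
  have wk: "w k * \<eta>\<^sup>2 = 1 / (2 * \<sigma>) * \<eta>\<^sup>2 + \<gamma> / (p k * n) * \<eta>\<^sup>2"
    by (simp add: w_def algebra_simps)
  have dual': "w k * (b - y\<^sub>s $ k)\<^sup>2 \<le> 1 / (2 * \<sigma>) * \<eta>\<^sup>2 - 1 / (2 * \<sigma>) * e\<^sup>2
      + \<kappa> * (a k \<bullet> (x\<^sub>b - x\<^sub>s)) * \<eta> + \<kappa> * (a k \<bullet> (x\<^sub>b - x\<^sub>s)) * e"
  proof -
    have "b - y\<^sub>s $ k = \<eta> + e" by (simp add: \<eta>_def e_def)
    then have "\<kappa> * (a k \<bullet> (x\<^sub>b - x\<^sub>s)) * (b - y\<^sub>s $ k)
        = \<kappa> * (a k \<bullet> (x\<^sub>b - x\<^sub>s)) * \<eta> + \<kappa> * (a k \<bullet> (x\<^sub>b - x\<^sub>s)) * e"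
      by (simp add: distrib_left)
    then show ?thesis using dual unfolding \<kappa>_def \<eta>_def e_def by linarith
  qed
  \<comment> \<open>The products of \<open>e\<close> with
    \<open>a k \<bullet> (x - x\<^sub>s)\<close> cancel. The primal step sees the change of
    \<open>u\<close> amplified by \<open>1 / p k\<close>, the potential sees it unamplified, hence
    the factor \<open>1 - p k\<close>; extrapolation contributes the \<open>\<theta>\<close>
    term.\<close>
  have inner: "- ((u + (1 / p k) *\<^sub>R ((1 / n * (b - y $ k)) *\<^sub>R a k) - u\<^sub>s) \<bullet> (m - x\<^sub>s))
      + (u + (e / n) *\<^sub>R a k - u\<^sub>s) \<bullet> D + \<kappa> * (a k \<bullet> (x\<^sub>b - x\<^sub>s)) * e
    = - ((u - u\<^sub>s) \<bullet> (x - x\<^sub>s)) + \<theta> * (\<kappa> * e * (a k \<bullet> d)) + (- ((1 - p k) * \<kappa> * e * (a k \<bullet> D)))"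
  proof -
    have dual_dir: "(1 / p k) *\<^sub>R ((1 / n * (b - y $ k)) *\<^sub>R a k) = (\<kappa> * e) *\<^sub>R a k"
      by (simp add: \<kappa>_def e_def mult.commute)
    have avg_dir: "(e / n) *\<^sub>R a k = (p k * \<kappa> * e) *\<^sub>R a k" using \<kappa>(2) by simp
    have m_diff: "m - x\<^sub>s = D + (x - x\<^sub>s)" by (simp add: D_def)
    have xb_diff: "x\<^sub>b - x\<^sub>s = (x - x\<^sub>s) + \<theta> *\<^sub>R d" by (simp add: xb)
    show ?thesis unfolding dual_dir avg_dir m_diff xb_diff
      by (simp add: inner_add_left inner_add_right inner_diff_left algebra_simps)
  qed
  have \<kappa>a: "\<kappa> * norm (a k) \<le> R / \<alpha>" using norm_a_le[of k] by (simp add: \<kappa>_def)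
  have cross: "\<bar>\<kappa> * e * (a k \<bullet> v)\<bar> \<le> R / \<alpha> * \<bar>e\<bar> * norm v" for v
  proof -
    have "\<bar>\<kappa> * e * (a k \<bullet> v)\<bar> = \<kappa> * \<bar>e\<bar> * \<bar>a k \<bullet> v\<bar>" using \<kappa> by (simp add: abs_mult)
    also have "\<dots> \<le> \<kappa> * \<bar>e\<bar> * (norm (a k) * norm v)"
      using \<kappa> by (intro mult_left_mono Cauchy_Schwarz_ineq2) auto
    also have "\<dots> = (\<kappa> * norm (a k)) * (\<bar>e\<bar> * norm v)" by (simp add: algebra_simps)
    also have "\<dots> \<le> R / \<alpha> * (\<bar>e\<bar> * norm v)" using \<kappa>a by (intro mult_right_mono) auto
    finally show ?thesis by (simp add: mult.assoc)
  qed
  have c1: "\<theta> * (\<kappa> * e * (a k \<bullet> d)) \<le> \<theta> * (1 / (4 * \<tau>) * (norm d)\<^sup>2) + 1 / (4 * \<sigma>) * e\<^sup>2"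
  proof -
    have "\<theta> * (\<kappa> * e * (a k \<bullet> d)) \<le> \<theta> * (1 / (4 * \<tau>) * (norm d)\<^sup>2 + 1 / (4 * \<sigma>) * e\<^sup>2)"
      using theta_pos by (intro mult_left_mono young cross) auto
    moreover have "\<theta> * (1 / (4 * \<sigma>) * e\<^sup>2) \<le> 1 * (1 / (4 * \<sigma>) * e\<^sup>2)"
      using theta_le1 sigma_pos by (intro mult_right_mono) auto
    ultimately show ?thesis by (simp add: distrib_left)
  qed
  have c2: "- ((1 - p k) * \<kappa> * e * (a k \<bullet> D)) \<le> 1 / (4 * \<tau>) * (norm D)\<^sup>2 + 1 / (4 * \<sigma>) * e\<^sup>2"
  proof (rule young)
    have "\<bar>- ((1 - p k) * \<kappa> * e * (a k \<bullet> D))\<bar> = \<bar>1 - p k\<bar> * \<bar>\<kappa> * e * (a k \<bullet> D)\<bar>"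
      by (simp add: abs_mult mult.assoc)
    also have "\<dots> \<le> 1 * \<bar>\<kappa> * e * (a k \<bullet> D)\<bar>"
      using p_le1[of k] p_pos[of k] by (intro mult_right_mono) auto
    finally show "\<bar>- ((1 - p k) * \<kappa> * e * (a k \<bullet> D))\<bar> \<le> R / \<alpha> * \<bar>e\<bar> * norm D"
      using cross[of D] by linarith
  qed
  \<comment> \<open>The budget closes: \<open>c1\<close> and \<open>c2\<close> together use the
    \<open>e\<^sup>2\<close> term of \<open>dual'\<close>, while \<open>c2\<close> and the potential
    itself use the \<open>(norm D)\<^sup>2\<close> term of \<open>primal\<close>.\<close>
  have half: "1 / (4 * \<sigma>) * e\<^sup>2 + 1 / (4 * \<sigma>) * e\<^sup>2 = 1 / (2 * \<sigma>) * e\<^sup>2"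
    "1 / (4 * \<tau>) * (norm D)\<^sup>2 + 1 / (4 * \<tau>) * (norm D)\<^sup>2 = 1 / (2 * \<tau>) * (norm D)\<^sup>2"
    by (simp_all add: field_simps)
  have comm: "\<kappa> * (a k \<bullet> (x\<^sub>b - x\<^sub>s)) * \<eta> = \<kappa> * \<eta> * (a k \<bullet> (x\<^sub>b - x\<^sub>s))" by simp
  show ?thesis
    unfolding pot \<kappa>_def[symmetric] \<eta>_def[symmetric]
    using primal[folded D_def] dual' wk inner c1 c2 half comm by linarith
qed

lemma potential_contraction:
  assumes "consistent S"
  shows "(\<Sum>k\<in>UNIV. p k * potential (spdc_step a \<phi> g \<alpha> \<tau> \<sigma> \<theta> k S)) \<le> \<theta> * potential S"
proof -
  obtain x y u x\<^sub>b where S: "S = (x, y, u, x\<^sub>b)" by (cases S)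
  define d where "d = increment S"
  define W where "W = (\<Sum>i\<in>UNIV. w i * (y $ i - y\<^sub>s $ i)\<^sup>2)"
  \<comment> \<open>The part of the one-step bound that does not depend on the sampled
    index.\<close>
  define C where "C = 1 / (2 * \<tau>) * (norm (x - x\<^sub>s))\<^sup>2 + W + \<theta> * (1 / (4 * \<tau>) * (norm d)\<^sup>2)
      - (u - u\<^sub>s) \<bullet> (x - x\<^sub>s)"
  have u: "u - u\<^sub>s = (1 / n) *\<^sub>R (\<Sum>i\<in>UNIV. (y $ i - y\<^sub>s $ i) *\<^sub>R a i)"
    using assms by (simp add: S consistent_def u\<^sub>s_def scaleR_diff_left sum_subtractf scaleR_diff_right)
  have xb: "x\<^sub>b = x + \<theta> *\<^sub>R d" using theta_pos by (simp add: d_def increment_def S)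
  have "(\<Sum>k\<in>UNIV. p k * potential (spdc_step a \<phi> g \<alpha> \<tau> \<sigma> \<theta> k S))
      \<le> (\<Sum>k\<in>UNIV. p k * (C - \<gamma> / (p k * n) * (y $ k - y\<^sub>s $ k)\<^sup>2
          + 1 / (n * p k) * (y $ k - y\<^sub>s $ k) * (a k \<bullet> (x\<^sub>b - x\<^sub>s))))"
  proof (intro sum_mono mult_left_mono)
    fix k
    show "potential (spdc_step a \<phi> g \<alpha> \<tau> \<sigma> \<theta> k S) \<le> C - \<gamma> / (p k * n) * (y $ k - y\<^sub>s $ k)\<^sup>2
          + 1 / (n * p k) * (y $ k - y\<^sub>s $ k) * (a k \<bullet> (x\<^sub>b - x\<^sub>s))"
      using potential_step_le[of k x y u x\<^sub>b] unfolding C_def W_def d_def S by linarith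
  qed (simp add: p_pos less_imp_le)
  also have "\<dots> = (\<Sum>k\<in>UNIV. p k * C - \<gamma> / n * (y $ k - y\<^sub>s $ k)\<^sup>2
      + 1 / n * ((y $ k - y\<^sub>s $ k) * (a k \<bullet> (x\<^sub>b - x\<^sub>s))))"
  proof (rule sum.cong[OF refl])
    fix k
    show "p k * (C - \<gamma> / (p k * n) * (y $ k - y\<^sub>s $ k)\<^sup>2
          + 1 / (n * p k) * (y $ k - y\<^sub>s $ k) * (a k \<bullet> (x\<^sub>b - x\<^sub>s)))
        = p k * C - \<gamma> / n * (y $ k - y\<^sub>s $ k)\<^sup>2 + 1 / n * ((y $ k - y\<^sub>s $ k) * (a k \<bullet> (x\<^sub>b - x\<^sub>s)))"
      using p_pos[of k] n_ge1 by (simp add: field_simps)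
  qed
  \<comment> \<open>The weights \<open>p k\<close> have cancelled the factors
    \<open>1 / p k\<close>, and consistency assembles the cross terms into
    \<open>u - u\<^sub>s\<close>. Subtracting the inner product in \<open>C\<close> leaves only the
    extrapolation part \<open>\<theta> *\<^sub>R d\<close>.\<close>
  also have "\<dots> = C - (\<Sum>k\<in>UNIV. \<gamma> / n * (y $ k - y\<^sub>s $ k)\<^sup>2) + (u - u\<^sub>s) \<bullet> (x\<^sub>b - x\<^sub>s)"
    unfolding sum.distrib sum_subtractf u
    by (simp add: sum_distrib_right[symmetric] sum_p inner_sum_left sum_divide_distrib)
  also have "\<dots> = 1 / (2 * \<tau>) * (norm (x - x\<^sub>s))\<^sup>2 + (\<Sum>k\<in>UNIV. (w k - \<gamma> / n) * (y $ k - y\<^sub>s $ k)\<^sup>2)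
      + \<theta> * ((u - u\<^sub>s) \<bullet> d) + \<theta> * (1 / (4 * \<tau>) * (norm d)\<^sup>2)"
    unfolding C_def W_def
    by (simp add: xb inner_add_right inner_diff_right sum_subtractf left_diff_distrib)
  also have "\<dots> \<le> \<theta> * (1 / (2 * \<tau>) + \<mu>) * (norm (x - x\<^sub>s))\<^sup>2
      + (\<Sum>k\<in>UNIV. \<theta> * w k * (y $ k - y\<^sub>s $ k)\<^sup>2)
      + \<theta> * ((u - u\<^sub>s) \<bullet> d) + \<theta> * (1 / (4 * \<tau>) * (norm d)\<^sup>2)"
    using theta_primal theta_dual by (intro add_mono sum_mono mult_right_mono order_refl) auto
  also have "\<dots> = \<theta> * potential S"
    by (simp add: potential_def S d_def distrib_left sum_distrib_left mult.assoc)
  finally show ?thesis .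
qed

lemma consistent_step:
  assumes "consistent S"
  shows "consistent (spdc_step a \<phi> g \<alpha> \<tau> \<sigma> \<theta> k S)"
proof -
  obtain x y u x\<^sub>b where S: "S = (x, y, u, x\<^sub>b)" by (cases S)
  obtain b m where step: "spdc_step a \<phi> g \<alpha> \<tau> \<sigma> \<theta> k (x, y, u, x\<^sub>b)
      = (m, (\<chi> i. if i = k then b else y $ i), u + (1 / n * (b - y $ k)) *\<^sub>R a k, m + \<theta> *\<^sub>R (m - x))"
    by (rule spdc_step_bounds)
  have "(\<Sum>i\<in>UNIV. (if i = k then b else y $ i) *\<^sub>R a i)
      = (\<Sum>i\<in>UNIV. (y $ i) *\<^sub>R a i + (if i = k then (b - y $ k) *\<^sub>R a k else 0))"
    by (rule sum.cong) (auto simp: scaleR_diff_left)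
  also have "\<dots> = (\<Sum>i\<in>UNIV. (y $ i) *\<^sub>R a i) + (b - y $ k) *\<^sub>R a k"
    by (simp add: sum.distrib)
  finally show ?thesis
    using assms unfolding S step consistent_def by (simp add: scaleR_add_right)
qed

lemma consistent_spdc: "consistent (spdc a \<phi> g \<alpha> \<tau> \<sigma> \<theta> x\<^sub>0 y\<^sub>0 ks t)"
  by (induction t) (simp_all add: consistent_step, simp add: consistent_def spdc_init_def n_eq[symmetric])

section \<open>Bounds on the potential and its expectation\<close>

lemma potential_lower:
  assumes "consistent (x, y, u, x\<^sub>b)"
  shows "(1 / (2 * \<tau>) + \<mu>) * (norm (x - x\<^sub>s))\<^sup>2 + (1 / (4 * \<sigma>) + \<gamma> / n) * (norm (y - y\<^sub>s))\<^sup>2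
    \<le> potential (x, y, u, x\<^sub>b)"
proof -
  define d where "d = increment (x, y, u, x\<^sub>b)"
  define N where "N = norm (y - y\<^sub>s)"
  have u: "u - u\<^sub>s = (1 / n) *\<^sub>R (\<Sum>i\<in>UNIV. (y $ i - y\<^sub>s $ i) *\<^sub>R a i)"
    using assms by (simp add: consistent_def u\<^sub>s_def scaleR_diff_left sum_subtractf scaleR_diff_right)
  have N: "\<bar>y $ i - y\<^sub>s $ i\<bar> \<le> N" for i
    using component_le_norm_cart[of "y - y\<^sub>s" i] by (simp add: N_def)
  have "norm (\<Sum>i\<in>UNIV. (y $ i - y\<^sub>s $ i) *\<^sub>R a i) \<le> (\<Sum>i\<in>UNIV. N * norm (a i))"
    using N by (intro sum_norm_le) (auto intro!: mult_right_mono)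
  also have "\<dots> = n * (R * N)" by (simp add: sum_distrib_left[symmetric] sum_norm)
  finally have "norm (u - u\<^sub>s) \<le> R * N"
    unfolding u using n_ge1 by (simp add: field_simps)
  \<comment> \<open>Weakened by \<open>\<alpha> < 1\<close> to match \<open>young\<close> with
    \<open>e = N\<close>, which costs \<open>N\<^sup>2 / (4 * \<sigma>)\<close>, half of the
    \<open>1 / (2 * \<sigma>)\<close> weight.\<close>
  also have "\<dots> \<le> R / \<alpha> * N"
    using alpha R_pos by (intro mult_right_mono) (auto simp: N_def field_simps)
  finally have "norm (u - u\<^sub>s) * norm d \<le> R / \<alpha> * N * norm d"
    by (rule mult_right_mono) simp
  then have "\<bar>- ((u - u\<^sub>s) \<bullet> d)\<bar> \<le> R / \<alpha> * \<bar>N\<bar> * norm d"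
    using Cauchy_Schwarz_ineq2[of "u - u\<^sub>s" d] by (simp add: N_def)
  from young[OF this]
  have "(u - u\<^sub>s) \<bullet> d + 1 / (4 * \<tau>) * (norm d)\<^sup>2 \<ge> - (1 / (4 * \<sigma>) * N\<^sup>2)" by simp
  moreover have "(\<Sum>i\<in>UNIV. w i * (y $ i - y\<^sub>s $ i)\<^sup>2)
      \<ge> (\<Sum>i\<in>UNIV. (1 / (2 * \<sigma>) + \<gamma> / n) * (y $ i - y\<^sub>s $ i)\<^sup>2)"
  proof (intro sum_mono mult_right_mono)
    fix i
    have "p i * n \<le> 1 * n" using p_le1[of i] n_ge1 by (intro mult_right_mono) auto
    then show "1 / (2 * \<sigma>) + \<gamma> / n \<le> w i"
      using p_pos[of i] n_ge1 gamma_pos unfolding w_def by (auto intro!: divide_left_mono)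
  qed auto
  moreover have "(\<Sum>i\<in>UNIV. c * (y $ i - y\<^sub>s $ i)\<^sup>2) = c * N\<^sup>2" for c
    by (simp add: N_def norm_vec_def L2_set_def sum_nonneg sum_distrib_left[symmetric])
  moreover have "(1 / (2 * \<sigma>) + \<gamma> / n) * N\<^sup>2 - 1 / (4 * \<sigma>) * N\<^sup>2 = (1 / (4 * \<sigma>) + \<gamma> / n) * N\<^sup>2"
    by (simp add: field_simps)
  ultimately show ?thesis
    by (simp add: potential_def d_def[symmetric] N_def[symmetric])
qed

text \<open>Initially the extrapolated point is \<open>x\<^sub>0\<close>, so the increment and its
  cross term vanish; \<open>n * p i \<ge> 1 - \<alpha>\<close> bounds the dual weights.\<close>

lemma potential_init:
  "potential (spdc_init a x\<^sub>0 y\<^sub>0)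
    \<le> (1 / (2 * \<tau>) + \<mu>) * (norm (x\<^sub>0 - x\<^sub>s))\<^sup>2 + (1 / (2 * \<sigma>) + \<gamma> / (1 - \<alpha>)) * (norm (y\<^sub>0 - y\<^sub>s))\<^sup>2"
proof -
  have "(\<Sum>i\<in>UNIV. w i * (y\<^sub>0 $ i - y\<^sub>s $ i)\<^sup>2) \<le> (\<Sum>i\<in>UNIV. (1 / (2 * \<sigma>) + \<gamma> / (1 - \<alpha>)) * (y\<^sub>0 $ i - y\<^sub>s $ i)\<^sup>2)"
  proof (intro sum_mono mult_right_mono)
    fix i
    have "1 - \<alpha> \<le> p i * n" using p_ge[of i] n_ge1 by (simp add: field_simps)
    then show "w i \<le> 1 / (2 * \<sigma>) + \<gamma> / (1 - \<alpha>)"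
      using p_pos[of i] n_ge1 gamma_pos alpha unfolding w_def by (auto intro!: divide_left_mono)
  qed auto
  also have "\<dots> = (1 / (2 * \<sigma>) + \<gamma> / (1 - \<alpha>)) * (norm (y\<^sub>0 - y\<^sub>s))\<^sup>2"
    by (simp add: norm_vec_def L2_set_def sum_nonneg sum_distrib_left[symmetric])
  finally show ?thesis by (simp add: potential_def spdc_init_def increment_def)
qed

lemma expected_potential:
  fixes x\<^sub>0 :: "real ^ 'd" and y\<^sub>0 :: "real ^ 'n"
  assumes M: "prob_space M"
    and indep: "prob_space.indep_vars M (\<lambda>_. count_space UNIV) K UNIV"
    and K: "\<And>s i. measure M {\<omega> \<in> space M. K s \<omega> = i} = p i"
  defines "S \<equiv> \<lambda>t \<omega>. spdc a \<phi> g \<alpha> \<tau> \<sigma> \<theta> x\<^sub>0 y\<^sub>0 (\<lambda>r. K r \<omega>) t"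
  shows "integral\<^sup>L M (\<lambda>\<omega>. potential (S t \<omega>)) \<le> \<theta> ^ t * potential (spdc_init a x\<^sub>0 y\<^sub>0)"
proof (induction t)
  case 0
  interpret prob_space M by fact
  show ?case by (simp add: S_def prob_space)
next
  case (Suc t)
  interpret prob_space M by fact
  note E = expectation_independent_index[OF M indep, where t = t and F = "\<lambda>ks. spdc a \<phi> g \<alpha> \<tau> \<sigma> \<theta> x\<^sub>0 y\<^sub>0 ks t",
      OF spdc_cong]
  let ?h = "\<lambda>k S. potential (spdc_step a \<phi> g \<alpha> \<tau> \<sigma> \<theta> k S)"
  \<comment> \<open>Taking an \<open>H\<close> that ignores the index makes every real function of
    the state integrable.\<close>
  have int: "integrable M (\<lambda>\<omega>. H (S t \<omega>))" for H :: "('n, 'd) spdc_state \<Rightarrow> real"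
    using E(1)[of "\<lambda>_. H"] unfolding S_def by simp
  have "expectation (\<lambda>\<omega>. potential (S (Suc t) \<omega>)) = expectation (\<lambda>\<omega>. ?h (K t \<omega>) (S t \<omega>))"
    by (simp add: S_def)
  also have "\<dots> = (\<Sum>k\<in>UNIV. p k * expectation (\<lambda>\<omega>. ?h k (S t \<omega>)))"
    using E(2)[of ?h] unfolding S_def by (simp add: K)
  also have "\<dots> = expectation (\<lambda>\<omega>. \<Sum>k\<in>UNIV. p k * ?h k (S t \<omega>))"
  proof -
    have "integrable M (\<lambda>\<omega>. ?h k (S t \<omega>))" for k by (rule int)
    then show ?thesis by simp
  qed
  \<comment> \<open>The contraction holds for every outcome, since every reachable state is
    consistent.\<close>
  also have "\<dots> \<le> expectation (\<lambda>\<omega>. \<theta> * potential (S t \<omega>))"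
    using int[of "\<lambda>S. \<Sum>k\<in>UNIV. p k * ?h k S"] int[of "\<lambda>S. \<theta> * potential S"]
    by (intro integral_mono) (auto simp: S_def intro!: potential_contraction consistent_spdc)
  also have "\<dots> = \<theta> * expectation (\<lambda>\<omega>. potential (S t \<omega>))" by simp
  also have "\<dots> \<le> \<theta> * (\<theta> ^ t * potential (spdc_init a x\<^sub>0 y\<^sub>0))"
    using Suc theta_pos by (intro mult_left_mono) auto
  finally show ?case by (simp add: mult.assoc)
qed

end

theorem theorem2:
  fixes a :: "'n::finite \<Rightarrow> real ^ 'd"
    and \<phi> :: "'n \<Rightarrow> real \<Rightarrow> real"
    and g :: "real ^ 'd \<Rightarrow> real"
    and \<gamma> \<mu> \<alpha> \<tau> \<sigma> \<theta> R n :: real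
    and x\<^sub>0 x\<^sub>s :: "real ^ 'd" and y\<^sub>0 y\<^sub>s :: "real ^ 'n"
    and M :: "'w measure" and K :: "nat \<Rightarrow> 'w \<Rightarrow> 'n"
    and x :: "nat \<Rightarrow> 'w \<Rightarrow> real ^ 'd" and y :: "nat \<Rightarrow> 'w \<Rightarrow> real ^ 'n"
    and t :: nat
  assumes "\<gamma> > 0" and "\<mu> > 0" and "0 < \<alpha>" and "\<alpha> < 1"
    and "\<And>i. convex_on UNIV (\<phi> i)"
    and "\<And>i z. \<phi> i differentiable (at z)"
    and "\<And>i. (1 / \<gamma>)-lipschitz_on UNIV (deriv (\<phi> i))"
    and "strongly_convex \<mu> g"
    and n_eq: "n = real CARD('n)"
    and R_eq: "R = 1 / n * (\<Sum>i\<in>UNIV. norm (a i))"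
    and "R > 0"
    and "saddle_point (lagrangian a \<phi> g) x\<^sub>s y\<^sub>s"
    and tau_eq: "\<tau> = \<alpha> / (2 * R) * sqrt (\<gamma> / (n * \<mu>))"
    and sigma_eq: "\<sigma> = \<alpha> / (2 * R) * sqrt (n * \<mu> / \<gamma>)"
    and theta_eq: "\<theta> = 1 - inverse (n / (1 - \<alpha>) + R / \<alpha> * sqrt (n / (\<mu> * \<gamma>)))"
    and "prob_space M"
    and "prob_space.indep_vars M (\<lambda>_. count_space UNIV) K UNIV"
    and "\<And>s i. measure M {\<omega> \<in> space M. K s \<omega> = i} = sampling_prob \<alpha> a i"
    and x_eq: "\<And>s \<omega>. x s \<omega> = spdc_primal a \<phi> g \<alpha> \<tau> \<sigma> \<theta> x\<^sub>0 y\<^sub>0 (\<lambda>r. K r \<omega>) s"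
    and y_eq: "\<And>s \<omega>. y s \<omega> = spdc_dual a \<phi> g \<alpha> \<tau> \<sigma> \<theta> x\<^sub>0 y\<^sub>0 (\<lambda>r. K r \<omega>) s"
    and "t \<ge> 1"
  shows "(1 / (2 * \<tau>) + \<mu>) * prob_space.expectation M (\<lambda>\<omega>. (norm (x t \<omega> - x\<^sub>s))\<^sup>2)
         + (1 / (4 * \<sigma>) + \<gamma> / n) * prob_space.expectation M (\<lambda>\<omega>. (norm (y t \<omega> - y\<^sub>s))\<^sup>2)
       \<le> \<theta> ^ t * ((1 / (2 * \<tau>) + \<mu>) * (norm (x\<^sub>0 - x\<^sub>s))\<^sup>2
                   + (1 / (2 * \<sigma>) + \<gamma> / (1 - \<alpha>)) * (norm (y\<^sub>0 - y\<^sub>s))\<^sup>2)"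
proof -
  interpret prob_space M by fact
  interpret spdc_analysis a \<phi> g \<gamma> \<mu> \<alpha> \<tau> \<sigma> \<theta> R n x\<^sub>s y\<^sub>s
    using assms(1-15) by unfold_locales auto
  define S where "S t \<omega> = spdc a \<phi> g \<alpha> \<tau> \<sigma> \<theta> x\<^sub>0 y\<^sub>0 (\<lambda>r. K r \<omega>) t" for t \<omega>
  have int: "integrable M (\<lambda>\<omega>. H (S t \<omega>))" for H :: "('n, 'd) spdc_state \<Rightarrow> real"
    using expectation_independent_index(1)[OF assms(16,17), where t = t and H = "\<lambda>_. H"
        and F = "\<lambda>ks. spdc a \<phi> g \<alpha> \<tau> \<sigma> \<theta> x\<^sub>0 y\<^sub>0 ks t", OF spdc_cong]
    unfolding S_def by simp
  have x: "x t \<omega> = fst (S t \<omega>)" and y: "y t \<omega> = fst (snd (S t \<omega>))" for \<omega>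
    by (simp_all add: x_eq y_eq spdc_primal_def spdc_dual_def S_def)
  let ?c = "1 / (2 * \<tau>) + \<mu>" and ?d = "1 / (4 * \<sigma>) + \<gamma> / n"
  let ?L = "\<lambda>S. ?c * (norm (fst S - x\<^sub>s))\<^sup>2 + ?d * (norm (fst (snd S) - y\<^sub>s))\<^sup>2"
  have lower: "?L (S t \<omega>) \<le> potential (S t \<omega>)" for \<omega>
  proof (cases "S t \<omega>")
    case (fields x' y' u' x\<^sub>b')
    then have "consistent (x', y', u', x\<^sub>b')"
      using consistent_spdc[of x\<^sub>0 y\<^sub>0 "\<lambda>r. K r \<omega>" t] by (simp add: S_def)
    from potential_lower[OF this] show ?thesis by (simp add: fields)
  qed
  \<comment> \<open>Integrability lets the two expectations merge, so that \<open>lower\<close> can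
    be applied outcome by outcome.\<close>
  have "?c * expectation (\<lambda>\<omega>. (norm (x t \<omega> - x\<^sub>s))\<^sup>2) + ?d * expectation (\<lambda>\<omega>. (norm (y t \<omega> - y\<^sub>s))\<^sup>2)
      = expectation (\<lambda>\<omega>. ?L (S t \<omega>))"
    unfolding x y
    using int[of "\<lambda>S. (norm (fst S - x\<^sub>s))\<^sup>2"] int[of "\<lambda>S. (norm (fst (snd S) - y\<^sub>s))\<^sup>2"] by simp
  also have "\<dots> \<le> expectation (\<lambda>\<omega>. potential (S t \<omega>))"
    using lower int[of ?L] int[of potential] by (intro integral_mono) auto
  also have "\<dots> \<le> \<theta> ^ t * potential (spdc_init a x\<^sub>0 y\<^sub>0)"
    unfolding S_def by (rule expected_potential) fact+
  also have "\<dots> \<le> \<theta> ^ t * (?c * (norm (x\<^sub>0 - x\<^sub>s))\<^sup>2 + (1 / (2 * \<sigma>) + \<gamma> / (1 - \<alpha>)) * (norm (y\<^sub>0 - y\<^sub>s))\<^sup>2)"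
    using theta_pos by (intro mult_left_mono potential_init) auto
  finally show ?thesis .
qed


end
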